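(* There is an absolute constant $C>0$ such that for every $d\ge 1$ and every $\epsilon\in(0,1/2]$ there exists a one-sided, adaptive $(\epsilon,\ell_1)$-tester for real symmetric $d\times d$ matrices that makes at most $C\,\frac{1}{\epsilon}\log^3\frac{1}{\epsilon}$ vector-matrix-vector queries.
   Context: For a real symmetric matrix $A$, $\|A\|_p$ denotes the Schatten-$p$ norm (the $\ell_p$ norm of the vector of singular values; $\|A\|_\infty$ is the operator norm), and $\lambda_{\min}(A)$ its smallest eigenvalue. PSD means positive semidefinite. A randomized algorithm has access to an unknown real symmetric $d\times d$ matrix $A$ only through vector-matrix-vector queries: it chooses $v,w\in\mathbb{R}^d$ and receives $v^TAw$. It is adaptive if queries may depend on previous answers (and on the algorithm's random coins). Computation is otherwise free; the number of queries is counted in the worst case over inputs and coins. For $p\in[1,\infty]$ and $\epsilon\in(0,1)$, an $(\epsilon,\ell_p)$-tester is such an algorithm that outputs True with probability at least $2/3$ if $A$ is PSD, and outputs False with probability at least $2/3$ if $A\neq 0$ and $\lambda_{\min}(A)\le-\epsilon\|A\|_p$. The tester is one-sided if on every PSD input it outputs True for every outcome of its random coins. *)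

theory Defs
  imports
    "HOL-Probability.Probability"
    "Jordan_Normal_Form.Char_Poly"
    "Jordan_Normal_Form.Spectral_Radius"
begin

text \<open>Matrices are those of Jordan_Normal_Form, whose dimension is a natural number rather
  than a type: the constant in the theorem has to be chosen before the dimension.\<close>

definition sym_mats :: "nat \<Rightarrow> real mat set" where
  "sym_mats d = {A \<in> carrier_mat d d. transpose_mat A = A}"

definition psd :: "nat \<Rightarrow> real mat \<Rightarrow> bool" where
  "psd d A \<longleftrightarrow> A \<in> sym_mats d \<and> (\<forall>v \<in> carrier_vec d. scalar_prod v (A *\<^sub>v v) \<ge> 0)"

text \<open>Nonempty and finite spectrum for symmetric matrices of dimension at least 1;
  \<^const>\<open>Min\<close> is unspecified for the empty matrix.\<close>

definition lambda_min :: "real mat \<Rightarrow> real" where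
  "lambda_min A = Min (spectrum A)"

text \<open>The square roots of the eigenvalues of \<open>A\<^sup>T A\<close>, with algebraic multiplicity. The
  characteristic polynomial of \<open>A\<^sup>T A\<close> splits over the reals, so no root is lost.\<close>

definition singular_values :: "real mat \<Rightarrow> real multiset" where
  "singular_values A = image_mset sqrt (proots (char_poly (transpose_mat A * A)))"

text \<open>Meant for \<open>1 \<le> p \<le> \<infinity>\<close>. Zero singular values contribute \<open>0 powr p = 0\<close>.\<close>

definition schatten_norm :: "ereal \<Rightarrow> real mat \<Rightarrow> real" where
  "schatten_norm p A =
     (if p = \<infinity> then Max (set_mset (singular_values A))
      else (\<Sum>s\<in>#singular_values A. s powr real_of_ereal p) powr (1 / real_of_ereal p))"

text \<open>A deterministic adaptive algorithm is a decision tree: an inner node asks the query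
  \<open>v\<^sup>T A w\<close> and continues with the subtree selected by the real number received. Since trees are
  well-founded, every run ends after finitely many queries. The matrix is accessed only in
  \<open>run\<close> and \<open>num_queries\<close>.\<close>

datatype query_tree =
    Output bool
  | Query "real vec" "real vec" "real \<Rightarrow> query_tree"

primrec queries_in_dim :: "nat \<Rightarrow> query_tree \<Rightarrow> bool" where
  "queries_in_dim d (Output b) \<longleftrightarrow> True"
| "queries_in_dim d (Query v w next_tree) \<longleftrightarrow>
     v \<in> carrier_vec d \<and> w \<in> carrier_vec d \<and> (\<forall>r. queries_in_dim d (next_tree r))"

primrec run :: "real mat \<Rightarrow> query_tree \<Rightarrow> bool" where
  "run A (Output b) = b"
| "run A (Query v w next_tree) = run A (next_tree (scalar_prod v (A *\<^sub>v w)))"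

primrec num_queries :: "real mat \<Rightarrow> query_tree \<Rightarrow> nat" where
  "num_queries A (Output b) = 0"
| "num_queries A (Query v w next_tree) = Suc (num_queries A (next_tree (scalar_prod v (A *\<^sub>v w))))"

text \<open>A randomized algorithm draws its coins \<open>\<omega>\<close> from a probability space \<open>M\<close> independently of the
  input, and then follows the tree \<open>T \<omega>\<close>. For every input the set of coins leading to
  acceptance must be an event.\<close>

definition vmv_algorithm :: "nat \<Rightarrow> 'c measure \<Rightarrow> ('c \<Rightarrow> query_tree) \<Rightarrow> bool" where
  "vmv_algorithm d M T \<longleftrightarrow>
     prob_space M \<and>
     (\<forall>\<omega> \<in> space M. queries_in_dim d (T \<omega>)) \<and>
     (\<forall>A \<in> sym_mats d. {\<omega> \<in> space M. run A (T \<omega>)} \<in> sets M)"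

definition psd_tester ::
    "nat \<Rightarrow> real \<Rightarrow> ereal \<Rightarrow> 'c measure \<Rightarrow> ('c \<Rightarrow> query_tree) \<Rightarrow> bool" where
  "psd_tester d \<epsilon> p M T \<longleftrightarrow>
     vmv_algorithm d M T \<and>
     (\<forall>A \<in> sym_mats d.
        (psd d A \<longrightarrow> measure M {\<omega> \<in> space M. run A (T \<omega>)} \<ge> 2 / 3) \<and>
        (A \<noteq> 0\<^sub>m d d \<and> lambda_min A \<le> - \<epsilon> * schatten_norm p A \<longrightarrow>
           measure M {\<omega> \<in> space M. \<not> run A (T \<omega>)} \<ge> 2 / 3))"

definition one_sided :: "nat \<Rightarrow> 'c measure \<Rightarrow> ('c \<Rightarrow> query_tree) \<Rightarrow> bool" where
  "one_sided d M T \<longleftrightarrow> (\<forall>A. psd d A \<longrightarrow> (\<forall>\<omega> \<in> space M. run A (T \<omega>)))"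

end

theory Submission
  imports Defs "Jordan_Normal_Form.Schur_Decomposition"
begin

text \<open>Let \<open>g\<close> be a uniformly random sign vector. Starting from a random sign vector \<open>x\<close>, the tester
  repeatedly replaces \<open>x\<close> by \<open>x - \<eta> (g\<^sup>T A x) g\<close>, a stochastic gradient step for the energy
  \<open>x\<^sup>T A x\<close>, and rejects once the energy is negative; hence it is one-sided. If \<open>A v = -\<mu> v\<close> with
  \<open>|v| = 1\<close>, a step multiplies the expectation of \<open>u = v\<^sup>T x\<close> by \<open>1 + \<eta> \<mu>\<close>, adds variance of order
  \<open>\<eta>\<^sup>2 |A x|\<^sup>2\<close>, and lowers the expected energy by about \<open>\<eta> |A x|\<^sup>2\<close>. The total variance is thus at most of
  order \<open>\<eta>\<close> times the initial energy as long as the energy stays nonnegative, so \<open>u\<close> does grow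
  geometrically, whereas \<open>|A x| \<ge> \<mu> |u|\<close> would then exhaust the energy. This takes
  \<open>O(log (1 / (\<eta> \<mu>)) / (\<eta> \<mu>))\<close> steps.

  The step size only has to be small against the inverse of the root mean square of \<open>g\<^sup>T A g\<close>. By
  hypercontractivity a single sample of \<open>g\<^sup>T A g\<close> has that order of magnitude with constant
  probability, and the root mean square is at most \<open>\<surd>3\<close> times the trace norm, so \<open>\<eta> \<mu>\<close> is at
  least of order \<open>\<epsilon>\<close>. The success probability of one trial is a tiny but absolute constant, which
  repetition amplifies because the error is one-sided.\<close>

no_notation inner (infix "\<bullet>" 70)
no_notation vec_nth (infixl "$" 90)

section \<open>Spectra and trace norms of symmetric matrices\<close>

definition mat_trace :: "'a::comm_ring_1 mat \<Rightarrow> 'a" where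
  "mat_trace A = (\<Sum>i<dim_row A. A $$ (i,i))"

lemma mat_trace_mult:
  assumes "A \<in> carrier_mat n m" "B \<in> carrier_mat m n"
  shows "mat_trace (A * B) = (\<Sum>i<n. \<Sum>j<m. A $$ (i,j) * B $$ (j,i))"
  using assms by (auto simp: mat_trace_def scalar_prod_def atLeast0LessThan intro!: sum.cong)

lemma mat_trace_comm:
  fixes A :: "'a::comm_ring_1 mat"
  assumes "A \<in> carrier_mat n m" "B \<in> carrier_mat m n"
  shows "mat_trace (A * B) = mat_trace (B * A)"
  unfolding mat_trace_mult[OF assms] mat_trace_mult[OF assms(2,1)]
  by (subst sum.swap) (simp add: mult.commute)

lemma mat_trace_similar:
  assumes "similar_mat_wit A B P Q"
  shows "mat_trace A = mat_trace B"
proof -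
  define n where "n = dim_row A"
  note w = similar_mat_witD[OF n_def assms]
  have "mat_trace A = mat_trace (P * (B * Q))"
    unfolding w(3) assoc_mult_mat[OF w(6,5,7)] ..
  also have "\<dots> = mat_trace (B * Q * P)"
    using w(5-7) by (intro mat_trace_comm mult_carrier_mat)
  also have "B * Q * P = B"
    unfolding assoc_mult_mat[OF w(5,7,6)] w(2) by (rule right_mult_one_mat[OF w(5)])
  finally show ?thesis .
qed

text \<open>Applied to a Schur form of a symmetric \<open>A\<close>, this reads off the eigenvalues
  of \<open>transpose_mat A * A = A * A\<close>, and so the singular values.\<close>

lemma upper_triangular_square:
  fixes B :: "'a::comm_ring_1 mat"
  assumes "B \<in> carrier_mat n n" "upper_triangular B"
  shows "upper_triangular (B * B)" "diag_mat (B * B) = map (\<lambda>a. a\<^sup>2) (diag_mat B)"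
proof -
  have e: "(B * B) $$ (i,j) = (\<Sum>k<n. B $$ (i,k) * B $$ (k,j))" if "i < n" "j < n" for i j
    using assms that by (auto simp: scalar_prod_def atLeast0LessThan intro!: sum.cong)
  have z: "B $$ (i,j) = 0" if "j < i" "i < n" for i j
    using assms that by (auto simp: upper_triangular_def)
  show "upper_triangular (B * B)"
  proof (rule upper_triangularI)
    fix i j assume ij: "j < i" "i < dim_row (B * B)"
    then have "(B * B) $$ (i,j) = (\<Sum>k<n. B $$ (i,k) * B $$ (k,j))"
      using e assms by auto
    also have "\<dots> = 0"
    proof (rule sum.neutral, rule ballI)
      fix k assume "k \<in> {..<n}"
      then show "B $$ (i,k) * B $$ (k,j) = 0"
        using ij assms z[of k i] z[of j k] by (cases "k < i") auto
    qed
    finally show "(B * B) $$ (i,j) = 0" .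
  qed
  have "(B * B) $$ (i,i) = (B $$ (i,i))\<^sup>2" if "i < n" for i
  proof -
    have "(B * B) $$ (i,i) = (\<Sum>k<n. if k = i then (B $$ (i,i))\<^sup>2 else 0)"
      unfolding e[OF that that]
    proof (rule sum.cong[OF refl])
      fix k assume "k \<in> {..<n}"
      then show "B $$ (i,k) * B $$ (k,i) = (if k = i then (B $$ (i,i))\<^sup>2 else 0)"
        using that z[of k i] z[of i k] by (cases "k < i") (auto simp: power2_eq_square)
    qed
    then show ?thesis using that by simp
  qed
  then show "diag_mat (B * B) = map (\<lambda>a. a\<^sup>2) (diag_mat B)"
    using assms by (auto simp: diag_mat_def)
qed

text \<open>Moving the symmetric matrix from \<open>v\<close> to \<open>conjugate v\<close> in their
  product multiplies the same nonzero number once by \<open>a\<close> and once by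
  \<open>conjugate a\<close>.\<close>

lemma symmetric_eigenvalue_real:
  fixes A :: "real mat"
  assumes A: "A \<in> sym_mats d" and e: "eigenvalue (map_mat complex_of_real A) a"
  shows "Im a = 0"
proof -
  let ?C = "map_mat complex_of_real A"
  have C: "?C \<in> carrier_mat d d" and Ct: "transpose_mat ?C = ?C"
    using A by (auto simp: sym_mats_def map_mat_transpose)
  obtain v where v: "v \<in> carrier_vec d" "v \<noteq> 0\<^sub>v d" "?C *\<^sub>v v = a \<cdot>\<^sub>v v"
    using e C by (auto simp: eigenvalue_def eigenvector_def)
  have cv: "conjugate v \<in> carrier_vec d" using v by simp
  have "conjugate (?C *\<^sub>v v) = ?C *\<^sub>v conjugate v"
  proof (rule eq_vecI)
    fix i assume "i < dim_vec (?C *\<^sub>v conjugate v)"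
    then have i: "i < d" using C by auto
    have "conjugate (?C *\<^sub>v v) $ i = conjugate (row ?C i \<bullet> v)" using i C by simp
    also have "\<dots> = conjugate (row ?C i) \<bullet> conjugate v"
      using i C v by (intro conjugate_sprod_vec) auto
    also have "conjugate (row ?C i) = row ?C i"
      using i A by (intro eq_vecI) (auto simp: sym_mats_def)
    finally show "conjugate (?C *\<^sub>v v) $ i = (?C *\<^sub>v conjugate v) $ i" using i C by simp
  qed (use C in auto)
  then have Cc: "?C *\<^sub>v conjugate v = conjugate a \<cdot>\<^sub>v conjugate v"
    using v by (simp add: conjugate_smult_vec)
  have "a * (v \<bullet> conjugate v) = (?C *\<^sub>v v) \<bullet> conjugate v"
    using v cv by simp
  also have "\<dots> = v \<bullet> (?C *\<^sub>v conjugate v)"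
    using transpose_vec_mult_scalar[OF C cv v(1)] Ct by simp
  also have "\<dots> = conjugate a * (v \<bullet> conjugate v)"
    using v cv Cc by simp
  finally have "a = conjugate a"
    using v(2) conjugate_square_eq_0_vec[OF v(1)] by simp
  then show ?thesis by (simp add: complex_eq_iff)
qed

text \<open>All complex roots are real, so the complex factorization is the image of a real one, and
  the embedding of polynomials is injective.\<close>

lemma symmetric_char_poly_splits:
  assumes A: "A \<in> sym_mats d"
  shows "\<exists>es. char_poly A = (\<Prod>a\<leftarrow>es. [:- a, 1:])"
proof -
  let ?C = "map_mat complex_of_real A"
  have Ac: "A \<in> carrier_mat d d" and C: "?C \<in> carrier_mat d d"
    using A by (auto simp: sym_mats_def)
  obtain as where as: "char_poly ?C = (\<Prod>a\<leftarrow>as. [:- a, 1:])"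
    using char_poly_factorized[OF C] by blast
  have re: "complex_of_real (Re a) = a" if "a \<in> set as" for a
  proof -
    have "poly (char_poly ?C) a = 0"
      using that unfolding as poly_prod_list by (auto simp: prod_list_zero_iff o_def)
    then show ?thesis
      using symmetric_eigenvalue_real[OF A, of a] eigenvalue_root_char_poly[OF C]
      by (simp add: complex_eq_iff)
  qed
  interpret h: map_poly_inj_idom_hom complex_of_real ..
  have "map_poly complex_of_real (\<Prod>a\<leftarrow>map Re as. [:- a, 1:])
      = (\<Prod>a\<leftarrow>as. map_poly complex_of_real [:- Re a, 1:])"
    by (simp add: h.hom_prod_list o_def)
  also have "\<dots> = (\<Prod>a\<leftarrow>as. [:- a, 1:])"
    by (rule arg_cong[of _ _ prod_list], rule map_cong[OF refl]) (simp add: re)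
  also have "\<dots> = map_poly complex_of_real (char_poly A)"
    unfolding as[symmetric] by (rule of_real_hom.char_poly_hom[OF Ac])
  finally have "char_poly A = (\<Prod>a\<leftarrow>map Re as. [:- a, 1:])" by (simp only: h.eq_iff)
  then show ?thesis ..
qed

text \<open>A real Schur form \<open>B\<close> does the work of an orthogonal diagonalization:
  similarity preserves characteristic polynomials and traces, and the same witnesses relate
  \<open>A * A\<close> to \<open>B * B\<close>. By symmetry the trace of \<open>A * A\<close> is the
  squared Frobenius norm.\<close>

lemma symmetric_spectral_data:
  assumes A: "A \<in> sym_mats d"
  obtains es where "length es = d" "char_poly A = (\<Prod>a\<leftarrow>es. [:- a, 1:])"
    "char_poly (transpose_mat A * A) = (\<Prod>a\<leftarrow>es. [:- (a\<^sup>2), 1:])"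
    "(\<Sum>i<d. A $$ (i,i)) = (\<Sum>a\<leftarrow>es. a)" "(\<Sum>i<d. \<Sum>j<d. (A $$ (i,j))\<^sup>2) = (\<Sum>a\<leftarrow>es. a\<^sup>2)"
proof -
  have Ac: "A \<in> carrier_mat d d" and At: "transpose_mat A = A"
    using A by (auto simp: sym_mats_def)
  obtain es where "char_poly A = (\<Prod>a\<leftarrow>es. [:- a, 1:])"
    using symmetric_char_poly_splits[OF A] by blast
  then obtain B where B: "B \<in> carrier_mat d d" "upper_triangular B" "similar_mat A B"
    using schur_upper_triangular[OF Ac] by blast
  then obtain P Q where w: "similar_mat_wit A B P Q" by (auto simp: similar_mat_def)
  have w2: "similar_mat_wit (A * A) (B * B) P Q"
    using similar_mat_wit_pow[OF w, of 2] Ac B by (simp add: numeral_2_eq_2)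
  have tr: "mat_trace C = (\<Sum>a\<leftarrow>diag_mat C. a)" if "C \<in> carrier_mat d d" for C :: "real mat"
    using that by (simp add: mat_trace_def diag_mat_def sum_list_sum_nth atLeast0LessThan)
  let ?es = "diag_mat B"
  note sq = upper_triangular_square[OF B(1,2)]
  have BB: "B * B \<in> carrier_mat d d" using B by simp
  show ?thesis
  proof
    show "length ?es = d" using B by (simp add: diag_mat_def)
    show "char_poly A = (\<Prod>a\<leftarrow>?es. [:- a, 1:])"
      using char_poly_similar[OF B(3)] char_poly_upper_triangular[OF B(1,2)] by simp
    have "char_poly (A * A) = char_poly (B * B)"
      using w2 by (intro char_poly_similar) (auto simp: similar_mat_def)
    then show "char_poly (transpose_mat A * A) = (\<Prod>a\<leftarrow>?es. [:- (a\<^sup>2), 1:])"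
      using char_poly_upper_triangular[OF BB sq(1)] sq(2) At by (simp add: o_def)
    show "(\<Sum>i<d. A $$ (i,i)) = (\<Sum>a\<leftarrow>?es. a)"
      using mat_trace_similar[OF w] tr[OF B(1)] Ac by (simp add: mat_trace_def)
    have "A $$ (j,i) = A $$ (i,j)" if "i < d" "j < d" for i j
      using that Ac index_transpose_mat(1)[of i A j] At by auto
    then have "(\<Sum>i<d. \<Sum>j<d. (A $$ (i,j))\<^sup>2) = mat_trace (A * A)"
      unfolding mat_trace_mult[OF Ac Ac] by (auto simp: power2_eq_square intro!: sum.cong)
    also have "\<dots> = mat_trace (B * B)" by (rule mat_trace_similar[OF w2])
    finally show "(\<Sum>i<d. \<Sum>j<d. (A $$ (i,j))\<^sup>2) = (\<Sum>a\<leftarrow>?es. a\<^sup>2)"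
      using tr[OF BB] sq(2) by (simp add: o_def)
  qed
qed

lemma sum_squares_le_square_sum_list:
  fixes es :: "real list"
  shows "(\<Sum>a\<leftarrow>es. a\<^sup>2) \<le> (\<Sum>a\<leftarrow>es. \<bar>a\<bar>)\<^sup>2"
proof (induction es)
  case (Cons a es)
  have "0 \<le> (\<Sum>a\<leftarrow>es. \<bar>a\<bar>)" by (intro sum_list_nonneg) auto
  then have "0 \<le> 2 * \<bar>a\<bar> * (\<Sum>a\<leftarrow>es. \<bar>a\<bar>)"
    by (intro mult_nonneg_nonneg) auto
  moreover have "(\<bar>a\<bar> + s)\<^sup>2 = a\<^sup>2 + s\<^sup>2 + 2 * \<bar>a\<bar> * s" for s
    unfolding power2_sum by simp
  ultimately show ?case using Cons by (simp only: list.map sum_list.Cons)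
qed simp

text \<open>The singular values are the absolute eigenvalues, so the norm is the sum of the
  \<open>\<bar>a\<bar>\<close>. It dominates the sum of the eigenvalues and their Euclidean
  norm.\<close>

lemma symmetric_schatten_1_bounds:
  assumes A: "A \<in> sym_mats d"
  shows "\<bar>\<Sum>i<d. A $$ (i,i)\<bar> \<le> schatten_norm 1 A" (is ?tr)
    and "(\<Sum>i<d. \<Sum>j<d. (A $$ (i,j))\<^sup>2) \<le> (schatten_norm 1 A)\<^sup>2" (is ?fr)
    and "A \<noteq> 0\<^sub>m d d \<Longrightarrow> 0 < schatten_norm 1 A"
proof -
  obtain es where es: "length es = d" "char_poly A = (\<Prod>a\<leftarrow>es. [:- a, 1:])"
    "char_poly (transpose_mat A * A) = (\<Prod>a\<leftarrow>es. [:- (a\<^sup>2), 1:])"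
    "(\<Sum>i<d. A $$ (i,i)) = (\<Sum>a\<leftarrow>es. a)" "(\<Sum>i<d. \<Sum>j<d. (A $$ (i,j))\<^sup>2) = (\<Sum>a\<leftarrow>es. a\<^sup>2)"
    by (rule symmetric_spectral_data[OF A])
  have nz: "(\<Prod>a\<leftarrow>xs. [:- (a\<^sup>2), 1:]) \<noteq> 0" for xs :: "real list"
    by (induction xs) (auto simp del: mult_pCons_left)
  have "proots (\<Prod>a\<leftarrow>es. [:- (a\<^sup>2), 1:]) = mset (map (\<lambda>a. a\<^sup>2) es)"
    by (induction es) (auto simp: proots_mult[OF _ nz] simp del: mult_pCons_left)
  then have "singular_values A = mset (map abs es)"
    unfolding singular_values_def es(3) by (simp add: multiset.map_comp o_def)
  moreover have "0 \<le> (\<Sum>a\<leftarrow>es. \<bar>a\<bar>)" by (rule sum_list_nonneg) auto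
  ultimately have n: "schatten_norm 1 A = (\<Sum>a\<leftarrow>es. \<bar>a\<bar>)"
    by (simp add: schatten_norm_def multiset.map_comp o_def sum_list_nonneg sum_mset_sum_list flip: mset_map)
  show ?tr unfolding es(4) n by (rule order_trans[OF sum_list_abs]) simp
  show fr: ?fr unfolding es(5) n by (rule sum_squares_le_square_sum_list)
  assume "A \<noteq> 0\<^sub>m d d"
  then obtain i j where ij: "i < d" "j < d" "A $$ (i,j) \<noteq> 0"
    using A eq_matI[of "0\<^sub>m d d" A] by (auto simp: sym_mats_def)
  have "0 < (\<Sum>i<d. \<Sum>j<d. (A $$ (i,j))\<^sup>2)"
    using ij by (intro sum_pos2[of _ i] sum_pos2[of _ j] sum_nonneg) auto
  with fr have "0 < (schatten_norm 1 A)\<^sup>2" by linarith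
  moreover have "0 \<le> schatten_norm 1 A" unfolding n by (rule sum_list_nonneg) auto
  ultimately show "0 < schatten_norm 1 A" by (simp add: less_le)
qed

lemma lambda_min_eigenvector:
  assumes A: "A \<in> sym_mats d" and d: "1 \<le> d"
  obtains v where "v \<in> carrier_vec d" "scalar_prod v v = 1" "A *\<^sub>v v = lambda_min A \<cdot>\<^sub>v v"
proof -
  have Ac: "A \<in> carrier_mat d d" using A by (simp add: sym_mats_def)
  obtain es where es: "length es = d" "char_poly A = (\<Prod>a\<leftarrow>es. [:- a, 1:])"
    "char_poly (transpose_mat A * A) = (\<Prod>a\<leftarrow>es. [:- (a\<^sup>2), 1:])"
    "(\<Sum>i<d. A $$ (i,i)) = (\<Sum>a\<leftarrow>es. a)" "(\<Sum>i<d. \<Sum>j<d. (A $$ (i,j))\<^sup>2) = (\<Sum>a\<leftarrow>es. a\<^sup>2)"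
    by (rule symmetric_spectral_data[OF A])
  \<comment> \<open>Since \<open>1 \<le> d\<close>, the list \<open>es\<close> is nonempty; hence so
    is the spectrum, and \<open>Min\<close> is attained.\<close>
  have "poly (char_poly A) (hd es) = 0"
    using es d unfolding es(2) by (cases es) auto
  then have "spectrum A \<noteq> {}" using spectrum_root_char_poly[OF Ac] by auto
  then have "lambda_min A \<in> spectrum A"
    unfolding lambda_min_def using card_finite_spectrum[OF Ac] by (intro Min_in)
  then obtain w where w: "w \<in> carrier_vec d" "w \<noteq> 0\<^sub>v d" "A *\<^sub>v w = lambda_min A \<cdot>\<^sub>v w"
    using Ac by (auto simp: spectrum_def eigenvalue_def eigenvector_def)
  have p: "0 < scalar_prod w w"
    using conjugate_square_greater_0_vec[OF w(1)] w(2) by simp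
  let ?c = "1 / sqrt (scalar_prod w w)"
  have sq: "sqrt (w \<bullet> w) * sqrt (w \<bullet> w) = w \<bullet> w" using p by simp
  show ?thesis
  proof
    show "?c \<cdot>\<^sub>v w \<in> carrier_vec d" using w by simp
    show "scalar_prod (?c \<cdot>\<^sub>v w) (?c \<cdot>\<^sub>v w) = 1" using w p sq by simp
    show "A *\<^sub>v (?c \<cdot>\<^sub>v w) = lambda_min A \<cdot>\<^sub>v (?c \<cdot>\<^sub>v w)"
      using w by (simp add: mult_mat_vec[OF Ac] smult_smult_assoc mult.commute)
  qed
qed

section \<open>Averages over sign vectors\<close>

text \<open>Expectation under the uniform distribution. The whole analysis uses such finite
  averages, with \<open>of_bool\<close> for events; a measure appears only when the tester is
  assembled.\<close>

definition avg :: "'a set \<Rightarrow> ('a \<Rightarrow> real) \<Rightarrow> real" where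
  "avg S f = (\<Sum>x\<in>S. f x) / real (card S)"

lemma avg_cong: "(\<And>x. x \<in> S \<Longrightarrow> f x = g x) \<Longrightarrow> avg S f = avg S g"
  by (simp add: avg_def)

lemma avg_mono: "(\<And>x. x \<in> S \<Longrightarrow> f x \<le> g x) \<Longrightarrow> avg S f \<le> avg S g"
  by (simp add: avg_def divide_right_mono sum_mono)

lemma avg_nonneg: "(\<And>x. x \<in> S \<Longrightarrow> 0 \<le> f x) \<Longrightarrow> 0 \<le> avg S f"
  by (simp add: avg_def sum_nonneg)

lemma avg_add: "avg S (\<lambda>x. f x + g x) = avg S f + avg S g"
  by (simp add: avg_def sum.distrib add_divide_distrib)

lemma avg_diff: "avg S (\<lambda>x. f x - g x) = avg S f - avg S g"
  by (simp add: avg_def sum_subtractf diff_divide_distrib)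

lemma avg_cmult: "avg S (\<lambda>x. c * f x) = c * avg S f"
  by (simp add: avg_def sum_distrib_left)

lemma avg_const: "finite S \<Longrightarrow> S \<noteq> {} \<Longrightarrow> avg S (\<lambda>_. c) = c"
  by (simp add: avg_def)

lemma avg_Cauchy_Schwarz: "(avg S (\<lambda>x. f x * g x))\<^sup>2 \<le> avg S (\<lambda>x. (f x)\<^sup>2) * avg S (\<lambda>x. (g x)\<^sup>2)"
  using divide_right_mono[OF Cauchy_Schwarz_ineq_sum[of f g S], of "(real (card S))\<^sup>2"]
  by (simp add: avg_def power_divide power2_eq_square)

lemma avg_singleton [simp]: "avg {x} f = f x"
  by (simp add: avg_def)

lemma avg_Times: "avg (S \<times> T) f = avg S (\<lambda>x. avg T (\<lambda>y. f (x, y)))"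
  by (simp add: avg_def sum.cartesian_product' flip: sum_divide_distrib)
    (simp add: card_cartesian_product mult.commute)

lemma avg_image: "inj_on h S \<Longrightarrow> avg (h ` S) f = avg S (\<lambda>x. f (h x))"
  by (simp add: avg_def sum.reindex card_image)

text \<open>Values below half the mean contribute at most half of it, so the event carries the other
  half. Cauchy-Schwarz then bounds its probability from below.\<close>

lemma paley_zygmund:
  assumes "finite S" "S \<noteq> {}" "0 < avg S f" "avg S (\<lambda>x. (f x)\<^sup>2) \<le> B * (avg S f)\<^sup>2" "0 < B"
  shows "1 / (4 * B) \<le> avg S (\<lambda>x. of_bool (avg S f / 2 \<le> f x))"
proof -
  let ?m = "avg S f" and ?i = "\<lambda>x. of_bool (avg S f / 2 \<le> f x) :: real"
  have "?m \<le> avg S (\<lambda>x. ?m / 2 + f x * ?i x)"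
    using assms(3) by (intro avg_mono) auto
  then have "?m / 2 \<le> avg S (\<lambda>x. f x * ?i x)"
    by (simp add: avg_add avg_const assms(1,2))
  then have "(?m / 2)\<^sup>2 \<le> (avg S (\<lambda>x. f x * ?i x))\<^sup>2"
    using assms(3) by (intro power_mono) auto
  also have "\<dots> \<le> avg S (\<lambda>x. (f x)\<^sup>2) * avg S (\<lambda>x. (?i x)\<^sup>2)"
    by (rule avg_Cauchy_Schwarz)
  also have "avg S (\<lambda>x. (?i x)\<^sup>2) = avg S ?i" by (intro avg_cong) auto
  also have "avg S (\<lambda>x. (f x)\<^sup>2) * avg S ?i \<le> B * ?m\<^sup>2 * avg S ?i"
    using assms(4) by (intro mult_right_mono avg_nonneg) auto
  finally have "?m\<^sup>2 * 1 \<le> ?m\<^sup>2 * (4 * B * avg S ?i)"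
    by (simp add: power_divide mult_ac)
  then have "1 \<le> 4 * B * avg S ?i" using assms(3) by (subst (asm) mult_le_cancel_left_pos) auto
  then show ?thesis using assms(5) by (simp add: field_simps)
qed

lemma avg_markov:
  assumes "\<And>x. x \<in> S \<Longrightarrow> 0 \<le> f x" "0 < c"
  shows "avg S (\<lambda>x. of_bool (c \<le> f x)) \<le> avg S f / c"
proof -
  have "avg S (\<lambda>x. c * of_bool (c \<le> f x)) \<le> avg S f"
    using assms by (intro avg_mono) auto
  then show ?thesis using assms(2) by (simp add: avg_cmult field_simps)
qed

section \<open>Uniform sign vectors and hypercontractivity\<close>

definition lists_of_length :: "'a set \<Rightarrow> nat \<Rightarrow> 'a list set" where
  "lists_of_length S n = {xs. set xs \<subseteq> S \<and> length xs = n}"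

lemma lists_of_length_0 [simp]: "lists_of_length S 0 = {[]}"
  by (auto simp: lists_of_length_def)

lemma lists_of_length_Suc: "lists_of_length S (Suc n) = (\<lambda>(x, xs). x # xs) ` (S \<times> lists_of_length S n)"
  by (force simp: lists_of_length_def length_Suc_conv image_iff)

lemma finite_lists_of_length: "finite S \<Longrightarrow> finite (lists_of_length S n)"
  unfolding lists_of_length_def by (rule finite_lists_length_eq)

lemma lists_of_length_nonempty: "S \<noteq> {} \<Longrightarrow> lists_of_length S n \<noteq> {}"
  by (induction n) (auto simp: lists_of_length_Suc)

lemma avg_lists_of_length_Suc:
  "avg (lists_of_length S (Suc n)) f = avg S (\<lambda>x. avg (lists_of_length S n) (\<lambda>xs. f (x # xs)))"
  unfolding lists_of_length_Suc by (subst avg_image) (auto simp: inj_on_def avg_Times)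

definition sign_lists :: "nat \<Rightarrow> real list set" where
  "sign_lists n = lists_of_length {-1, 1} n"

lemma length_sign_lists: "l \<in> sign_lists n \<Longrightarrow> length l = n"
  by (simp add: sign_lists_def lists_of_length_def)

lemma finite_sign_lists: "finite (sign_lists n)" and sign_lists_nonempty: "sign_lists n \<noteq> {}"
  by (auto simp: sign_lists_def finite_lists_of_length lists_of_length_nonempty)

lemmas avg_sign_const = avg_const[OF finite_sign_lists sign_lists_nonempty]

lemma avg_sign_0: "avg (sign_lists 0) f = f []"
  by (simp add: sign_lists_def)

lemma avg_sign_Suc:
  "avg (sign_lists (Suc n)) f =
     (avg (sign_lists n) (\<lambda>l. f (1 # l)) + avg (sign_lists n) (\<lambda>l. f (-1 # l))) / 2"
  unfolding sign_lists_def avg_lists_of_length_Suc by (simp add: avg_def[of "{-1, 1}"])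

text \<open>On \<open>sign_lists n\<close> the function agrees with a multilinear polynomial of degree at most \<open>k\<close>.\<close>

primrec sign_poly :: "nat \<Rightarrow> nat \<Rightarrow> (real list \<Rightarrow> real) \<Rightarrow> bool" where
  "sign_poly 0 k f \<longleftrightarrow> True"
| "sign_poly (Suc n) k f \<longleftrightarrow> (\<exists>a b. sign_poly n k a \<and>
     (case k of 0 \<Rightarrow> b = (\<lambda>_. 0) | Suc j \<Rightarrow> sign_poly n j b) \<and>
     (\<forall>l \<in> sign_lists n. \<forall>x \<in> {-1, 1}. f (x # l) = a l + x * b l))"

text \<open>The first sign is independent of the rest and has mean 0, so the cross term cancels
  between its two values.\<close>

lemma avg_sign_square:
  assumes "\<And>l x. l \<in> sign_lists n \<Longrightarrow> x \<in> {-1, 1} \<Longrightarrow> f (x # l) = a l + x * b l"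
  shows "avg (sign_lists (Suc n)) (\<lambda>l. (f l)\<^sup>2) =
    avg (sign_lists n) (\<lambda>l. (a l)\<^sup>2) + avg (sign_lists n) (\<lambda>l. (b l)\<^sup>2)"
proof -
  have "avg (sign_lists (Suc n)) (\<lambda>l. (f l)\<^sup>2) =
    (avg (sign_lists n) (\<lambda>l. (a l + b l)\<^sup>2) + avg (sign_lists n) (\<lambda>l. (a l - b l)\<^sup>2)) / 2"
    unfolding avg_sign_Suc by (intro arg_cong2[where f = "(/)"] arg_cong2[where f = "(+)"] avg_cong)
      (simp_all add: assms)
  also have "\<dots> = avg (sign_lists n) (\<lambda>l. (1/2) * ((a l + b l)\<^sup>2 + (a l - b l)\<^sup>2))"
    by (simp only: avg_cmult avg_add)
  also have "\<dots> = avg (sign_lists n) (\<lambda>l. (a l)\<^sup>2 + (b l)\<^sup>2)"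
    by (intro avg_cong) (simp add: power2_eq_square algebra_simps)
  finally show ?thesis by (simp add: avg_add)
qed

lemma avg_sign_fourth:
  assumes "\<And>l x. l \<in> sign_lists n \<Longrightarrow> x \<in> {-1, 1} \<Longrightarrow> f (x # l) = a l + x * b l"
  shows "avg (sign_lists (Suc n)) (\<lambda>l. (f l)^4) =
    avg (sign_lists n) (\<lambda>l. (a l)^4) + 6 * avg (sign_lists n) (\<lambda>l. (a l)\<^sup>2 * (b l)\<^sup>2)
      + avg (sign_lists n) (\<lambda>l. (b l)^4)"
proof -
  have "avg (sign_lists (Suc n)) (\<lambda>l. (f l)^4) =
    (avg (sign_lists n) (\<lambda>l. (a l + b l)^4) + avg (sign_lists n) (\<lambda>l. (a l - b l)^4)) / 2"
    unfolding avg_sign_Suc by (intro arg_cong2[where f = "(/)"] arg_cong2[where f = "(+)"] avg_cong)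
      (simp_all add: assms)
  also have "\<dots> = avg (sign_lists n) (\<lambda>l. (1/2) * ((a l + b l)^4 + (a l - b l)^4))"
    by (simp only: avg_cmult avg_add)
  also have "\<dots> = avg (sign_lists n) (\<lambda>l. (a l)^4 + 6 * ((a l)\<^sup>2 * (b l)\<^sup>2) + (b l)^4)"
    by (intro avg_cong) (simp add: power2_eq_square power4_eq_xxxx algebra_simps)
  finally show ?thesis by (simp add: avg_add avg_cmult)
qed

lemma fourth_power_square: "(x::real)^4 = (x\<^sup>2)\<^sup>2"
  by simp

text \<open>Bonami's inequality for the exponents 2 and 4.\<close>

lemma sign_poly_hypercontractive:
  "sign_poly n k f \<Longrightarrow>
    avg (sign_lists n) (\<lambda>l. (f l)^4) \<le> 9^k * (avg (sign_lists n) (\<lambda>l. (f l)\<^sup>2))\<^sup>2"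
proof (induction n arbitrary: k f)
  case 0
  have "1 * ((f [])\<^sup>2)\<^sup>2 \<le> 9^k * ((f [])\<^sup>2)\<^sup>2"
    by (intro mult_right_mono) auto
  then show ?case by (simp add: avg_sign_0)
next
  case (Suc n)
  from Suc.prems obtain a b where ab: "sign_poly n k a" "case k of 0 \<Rightarrow> b = (\<lambda>_. 0) | Suc j \<Rightarrow> sign_poly n j b"
    and f: "\<And>l x. l \<in> sign_lists n \<Longrightarrow> x \<in> {-1, 1} \<Longrightarrow> f (x # l) = a l + x * b l"
    unfolding sign_poly.simps by blast
  let ?E = "avg (sign_lists n)"
  let ?A = "?E (\<lambda>l. (a l)\<^sup>2)" and ?B = "?E (\<lambda>l. (b l)\<^sup>2)" and ?M = "?E (\<lambda>l. (a l)\<^sup>2 * (b l)\<^sup>2)"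
  have sq: "avg (sign_lists (Suc n)) (\<lambda>l. (f l)\<^sup>2) = ?A + ?B"
    by (intro avg_sign_square f)
  have qu: "avg (sign_lists (Suc n)) (\<lambda>l. (f l)^4) = ?E (\<lambda>l. (a l)^4) + 6 * ?M + ?E (\<lambda>l. (b l)^4)"
    by (intro avg_sign_fourth f)
  have A4: "?E (\<lambda>l. (a l)^4) \<le> 9^k * ?A\<^sup>2" by (rule Suc.IH[OF ab(1)])
  have nn: "0 \<le> ?A" "0 \<le> ?B" "0 \<le> ?E (\<lambda>l. (b l)^4)" by (auto intro: avg_nonneg)
  show ?case
  proof (cases k)
    case 0
    with ab(2) have b: "b = (\<lambda>_. 0)" by simp
    show ?thesis
      unfolding sq qu using A4 by (simp add: b avg_sign_const)
  next
    case (Suc j)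
    define p :: real where "p = 9^j"
    \<comment> \<open>Cauchy-Schwarz bounds the mixed moment by \<open>3 * p * x * y\<close>. Its
      coefficient 6 makes this \<open>18 * p * x * y\<close>, the cross term of
      \<open>9 * p * (x + y)^2\<close>: this is why one degree costs a factor 9.\<close>
    have e1: "(9 * p * x\<^sup>2) * (p * y\<^sup>2) = (3 * p * x * y)\<^sup>2"
      and e2: "9 * p * x\<^sup>2 + 6 * (3 * p * x * y) + 9 * (p * y\<^sup>2) = 9 * p * (x + y)\<^sup>2" for x y :: real
      by (simp_all add: power2_eq_square algebra_simps)
    have p: "0 < p" and k: "9^k = 9 * p" by (simp_all add: p_def Suc)
    from Suc ab(2) have B4: "?E (\<lambda>l. (b l)^4) \<le> p * ?B\<^sup>2"
      unfolding p_def by (intro Suc.IH) simp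
    have "?M\<^sup>2 \<le> ?E (\<lambda>l. (a l)^4) * ?E (\<lambda>l. (b l)^4)"
      unfolding fourth_power_square by (rule avg_Cauchy_Schwarz)
    also have "\<dots> \<le> (9 * p * ?A\<^sup>2) * (p * ?B\<^sup>2)"
      using nn p A4 B4 unfolding k by (intro mult_mono) auto
    also have "\<dots> = (3 * p * ?A * ?B)\<^sup>2"
      by (rule e1)
    finally have M: "?M \<le> 3 * p * ?A * ?B"
      by (rule power2_le_imp_le) (use nn p in auto)
    have "0 \<le> p * ?B\<^sup>2" using p by simp
    then have "?E (\<lambda>l. (a l)^4) + 6 * ?M + ?E (\<lambda>l. (b l)^4)
        \<le> 9 * p * ?A\<^sup>2 + 6 * (3 * p * ?A * ?B) + 9 * (p * ?B\<^sup>2)"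
      using A4 M B4 unfolding k by linarith
    also have "\<dots> = 9^k * (?A + ?B)\<^sup>2"
      unfolding k by (rule e2)
    finally show ?thesis unfolding sq qu .
  qed
qed

section \<open>Linear and quadratic forms in random signs\<close>

definition lin_form :: "(nat \<Rightarrow> real) \<Rightarrow> real list \<Rightarrow> real" where
  "lin_form b l = (\<Sum>i<length l. b i * l ! i)"

definition quad_form :: "(nat \<Rightarrow> nat \<Rightarrow> real) \<Rightarrow> real list \<Rightarrow> real" where
  "quad_form A l = (\<Sum>i<length l. \<Sum>j<length l. A i j * l ! i * l ! j)"

lemma lin_form_Nil [simp]: "lin_form b [] = 0" and quad_form_Nil [simp]: "quad_form A [] = 0"
  by (simp_all add: lin_form_def quad_form_def)

lemma lin_form_Cons: "lin_form b (x # l) = b 0 * x + lin_form (\<lambda>i. b (Suc i)) l"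
  by (simp add: lin_form_def sum.lessThan_Suc_shift del: sum.lessThan_Suc)

text \<open>A sign squares to 1, so the diagonal entry becomes a constant and the form is affine in
  the first sign.\<close>

lemma quad_form_Cons:
  assumes "x \<in> {-1, 1}"
  shows "quad_form A (x # l) = A 0 0 + quad_form (\<lambda>i j. A (Suc i) (Suc j)) l
    + x * lin_form (\<lambda>i. A 0 (Suc i) + A (Suc i) 0) l"
proof -
  have "x * x = 1" using assms by auto
  then have "A 0 0 * x * x = A 0 0" by (simp add: mult.assoc)
  then show ?thesis
    by (simp add: lin_form_def quad_form_def sum.lessThan_Suc_shift sum.distrib sum_distrib_left
        algebra_simps del: sum.lessThan_Suc)
qed

lemma sign_poly_const: "sign_poly n k (\<lambda>_. c)"
proof (induction n arbitrary: k c)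
  case (Suc n)
  then show ?case
    unfolding sign_poly.simps by (intro exI[of _ "\<lambda>_. c"] exI[of _ "\<lambda>_. 0"]) (auto split: nat.split)
qed simp

lemma sign_poly_lin_form: "sign_poly n 1 (\<lambda>l. c + lin_form b l)"
proof (induction n arbitrary: c b)
  case (Suc n)
  show ?case
    unfolding sign_poly.simps
    by (intro exI[of _ "\<lambda>l. c + lin_form (\<lambda>i. b (Suc i)) l"] exI[of _ "\<lambda>_. b 0"])
      (use Suc in \<open>auto simp: lin_form_Cons sign_poly_const\<close>)
qed simp

text \<open>The constant \<open>c\<close> is there for the induction: it collects the diagonal
  entries that are split off.\<close>

lemma sign_poly_quad_form: "sign_poly n 2 (\<lambda>l. c + quad_form A l)"
proof (induction n arbitrary: c A)
  case (Suc n)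
  show ?case
    unfolding sign_poly.simps
    by (intro exI[of _ "\<lambda>l. (c + A 0 0) + quad_form (\<lambda>i j. A (Suc i) (Suc j)) l"]
         exI[of _ "\<lambda>l. 0 + lin_form (\<lambda>i. A 0 (Suc i) + A (Suc i) 0) l"] conjI Suc)
      (use sign_poly_lin_form[of n 0] in \<open>auto simp: quad_form_Cons numeral_2_eq_2\<close>)
qed simp

text \<open>Fixing the first sign shifts the constants, so the induction has to carry
  \<open>c\<close> and \<open>e\<close>.\<close>

lemma avg_lin_form_mult:
  "avg (sign_lists n) (\<lambda>l. (c + lin_form a l) * (e + lin_form b l)) = c * e + (\<Sum>i<n. a i * b i)"
proof (induction n arbitrary: c e a b)
  case (Suc n)
  show ?case
    unfolding avg_sign_Suc lin_form_Cons add.assoc[symmetric] Suc.IH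
    by (simp add: sum.lessThan_Suc_shift field_simps del: sum.lessThan_Suc)
qed (simp add: avg_sign_0)

lemma avg_lin_form_square: "avg (sign_lists n) (\<lambda>l. (lin_form b l)\<^sup>2) = (\<Sum>i<n. (b i)\<^sup>2)"
  using avg_lin_form_mult[of n 0 b 0 b] by (simp add: power2_eq_square)

text \<open>The mean is \<open>c\<close> plus the trace. Each sign that is split off adds an
  orthogonal linear form, whose square average is at most twice the squares of the first row and
  column.\<close>

lemma avg_quad_form_square_le:
  "avg (sign_lists n) (\<lambda>l. (c + quad_form A l)\<^sup>2)
    \<le> (c + (\<Sum>i<n. A i i))\<^sup>2 + 2 * (\<Sum>i<n. \<Sum>j<n. (A i j)\<^sup>2)"
proof (induction n arbitrary: c A)
  case (Suc n)
  let ?A = "\<lambda>i j. A (Suc i) (Suc j)" and ?r = "\<lambda>i. A 0 (Suc i) + A (Suc i) 0"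
  have "avg (sign_lists (Suc n)) (\<lambda>l. (c + quad_form A l)\<^sup>2)
     = avg (sign_lists n) (\<lambda>l. ((c + A 0 0) + quad_form ?A l)\<^sup>2) + avg (sign_lists n) (\<lambda>l. (lin_form ?r l)\<^sup>2)"
    by (rule avg_sign_square) (simp add: quad_form_Cons)
  also have "\<dots> \<le> ((c + A 0 0) + (\<Sum>i<n. ?A i i))\<^sup>2 + 2 * (\<Sum>i<n. \<Sum>j<n. (?A i j)\<^sup>2) + (\<Sum>i<n. (?r i)\<^sup>2)"
    unfolding avg_lin_form_square by (intro add_right_mono Suc.IH)
  also have "(\<Sum>i<n. (?r i)\<^sup>2) \<le> (\<Sum>i<n. 2 * (A 0 (Suc i))\<^sup>2 + 2 * (A (Suc i) 0)\<^sup>2)"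
  proof (rule sum_mono)
    fix i
    show "(?r i)\<^sup>2 \<le> 2 * (A 0 (Suc i))\<^sup>2 + 2 * (A (Suc i) 0)\<^sup>2"
      using zero_le_power2[of "A 0 (Suc i) - A (Suc i) 0"] unfolding power2_sum power2_diff by linarith
  qed
  also have "((c + A 0 0) + (\<Sum>i<n. ?A i i))\<^sup>2 + 2 * (\<Sum>i<n. \<Sum>j<n. (?A i j)\<^sup>2)
      + (\<Sum>i<n. 2 * (A 0 (Suc i))\<^sup>2 + 2 * (A (Suc i) 0)\<^sup>2)
    \<le> (c + (\<Sum>i<Suc n. A i i))\<^sup>2 + 2 * (\<Sum>i<Suc n. \<Sum>j<Suc n. (A i j)\<^sup>2)"
    by (simp add: sum.lessThan_Suc_shift sum.distrib sum_distrib_left add.assoc del: sum.lessThan_Suc)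
  finally show ?case by simp
qed (simp add: avg_sign_0)

section \<open>Random gradient steps\<close>

text \<open>Here \<open>y\<close> stands for \<open>g^T A x\<close>, \<open>s\<close> for
  \<open>g^T A g\<close>, \<open>\<beta>\<close> for \<open>|A x|^2\<close> and \<open>Q\<close> for
  the energy. If \<open>y^2 \<ge> \<beta> / 2\<close> and \<open>\<eta> * s \<le> 1\<close>, the
  energy drops by at least \<open>\<eta> * y^2 \<ge> \<eta> * \<beta> / 2 > Q\<close>. The first
  event has probability at least 1/36, and the second fails with probability at most 1/972.\<close>

lemma descent_succeeds:
  assumes fin: "finite S" "S \<noteq> {}" and eta: "0 < \<eta>" and small: "\<eta>\<^sup>2 * V \<le> 1 / 972"
    and y2: "avg S (\<lambda>l. (y l)\<^sup>2) = \<beta>" and y4: "avg S (\<lambda>l. (y l)^4) \<le> 9 * \<beta>\<^sup>2"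
    and s2: "avg S (\<lambda>l. (s l)\<^sup>2) \<le> V"
    and Q: "0 \<le> Q" "2 * Q < \<eta> * \<beta>"
  shows "1 / 72 \<le> avg S (\<lambda>l. of_bool (Q - 2 * \<eta> * (y l)\<^sup>2 + \<eta>\<^sup>2 * (y l)\<^sup>2 * s l < 0))"
proof -
  have "0 < \<eta> * \<beta>" using Q by linarith
  then have \<beta>: "0 < \<beta>" using eta by (simp add: zero_less_mult_iff)
  have pz: "1 / (4 * 9) \<le> avg S (\<lambda>l. of_bool (\<beta> / 2 \<le> (y l)\<^sup>2))"
    using paley_zygmund[of S "\<lambda>l. (y l)\<^sup>2" 9] fin y2 y4 \<beta> by simp
  have "avg S (\<lambda>l. of_bool (1 \<le> (\<eta> * s l)\<^sup>2)) \<le> avg S (\<lambda>l. (\<eta> * s l)\<^sup>2) / 1"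
    by (rule avg_markov) auto
  also have "\<dots> = \<eta>\<^sup>2 * avg S (\<lambda>l. (s l)\<^sup>2)" by (simp add: power_mult_distrib avg_cmult)
  also have "\<dots> \<le> \<eta>\<^sup>2 * V" using s2 by (intro mult_left_mono) auto
  finally have mk: "avg S (\<lambda>l. of_bool (1 \<le> (\<eta> * s l)\<^sup>2)) \<le> 1 / 972" using small by linarith
  have "avg S (\<lambda>l. of_bool (\<beta> / 2 \<le> (y l)\<^sup>2) - of_bool (1 \<le> (\<eta> * s l)\<^sup>2))
     \<le> avg S (\<lambda>l. of_bool (Q - 2 * \<eta> * (y l)\<^sup>2 + \<eta>\<^sup>2 * (y l)\<^sup>2 * s l < 0))"
  proof (rule avg_mono)
    fix l
    have "Q - 2 * \<eta> * (y l)\<^sup>2 + \<eta>\<^sup>2 * (y l)\<^sup>2 * s l < 0"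
      if a: "\<beta> / 2 \<le> (y l)\<^sup>2" and b: "\<not> 1 \<le> (\<eta> * s l)\<^sup>2"
    proof -
      have "\<eta> * s l \<le> 1" using b power_mono[of 1 "\<eta> * s l" 2] by fastforce
      then have "\<eta> * (y l)\<^sup>2 * (\<eta> * s l) \<le> \<eta> * (y l)\<^sup>2 * 1"
        using eta by (intro mult_left_mono) auto
      moreover have "\<eta> * (\<beta> / 2) \<le> \<eta> * (y l)\<^sup>2"
        using a eta by (intro mult_left_mono) auto
      ultimately show ?thesis using Q by (simp add: power2_eq_square algebra_simps)
    qed
    then show "of_bool (\<beta> / 2 \<le> (y l)\<^sup>2) - of_bool (1 \<le> (\<eta> * s l)\<^sup>2)
      \<le> (of_bool (Q - 2 * \<eta> * (y l)\<^sup>2 + \<eta>\<^sup>2 * (y l)\<^sup>2 * s l < 0) :: real)" by auto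
  qed
  then show ?thesis using pz mk unfolding avg_diff by linarith
qed

text \<open>The summand \<open>w * r\<^sup>2\<close> is the price for curvature. The quadratic in \<open>w\<close> bounds
  \<open>min w (D / 2)\<close> from below, by \<open>min a t \<ge> a - a\<^sup>2 / (4 * t)\<close> at \<open>a = w / 9\<close>.\<close>

lemma truncated_energy_le:
  fixes Q :: real
  assumes "0 < D" "D \<le> 2 * Q" "0 \<le> w"
  shows "max 0 (Q - 2 * w + w * r) \<le> Q - (w / 9 - w\<^sup>2 / (162 * D)) + w * r\<^sup>2"
proof -
  have "0 \<le> (w / 9 - D)\<^sup>2 / (2 * D)" using assms by simp
  also have "\<dots> = w\<^sup>2 / (162 * D) - w / 9 + D / 2"
    using assms by (simp add: power2_eq_square field_simps)
  finally have a: "w / 9 - w\<^sup>2 / (162 * D) \<le> D / 2" by simp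
  have "0 \<le> w\<^sup>2 / (162 * D)" using assms by simp
  then have b: "w / 9 - w\<^sup>2 / (162 * D) \<le> w" using assms(3) by linarith
  have "0 \<le> (r - 1/2)\<^sup>2 + 3/4" by simp
  then have "0 \<le> w * ((r - 1/2)\<^sup>2 + 3/4)" using assms(3) by (rule mult_nonneg_nonneg[rotated])
  then have c: "w * r \<le> w + w * r\<^sup>2" by (simp add: power2_eq_square algebra_simps)
  have "0 \<le> w * r\<^sup>2" using assms by simp
  \<comment> \<open>The value 0 of the maximum is covered by \<open>a\<close> and
    \<open>D / 2 \<le> Q\<close>, the other value by \<open>b\<close> and \<open>c\<close>.\<close>
  then show ?thesis using a b c assms by simp
qed

text \<open>The regime complementary to \<open>descent_succeeds\<close>. In units of
  \<open>\<eta> * \<beta>\<close>, the linear term gains 1/9, the fourth moment costs at most 1/18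
  and curvature at most 27/972 = 1/36, which leaves a net gain of 1/36.\<close>

lemma descent_decreases:
  assumes fin: "finite S" "S \<noteq> {}" and eta: "0 < \<eta>" and small: "\<eta>\<^sup>2 * V \<le> 1 / 972"
    and y2: "avg S (\<lambda>l. (y l)\<^sup>2) = \<beta>" and y4: "avg S (\<lambda>l. (y l)^4) \<le> 9 * \<beta>\<^sup>2"
    and sy: "avg S (\<lambda>l. (s l)\<^sup>2 * (y l)\<^sup>2) \<le> 27 * V * \<beta>"
    and Q: "\<eta> * \<beta> \<le> 2 * Q"
  shows "avg S (\<lambda>l. max 0 (Q - 2 * \<eta> * (y l)\<^sup>2 + \<eta>\<^sup>2 * (y l)\<^sup>2 * s l)) \<le> Q - \<eta> * \<beta> / 36"
\<comment> \<open>The truncated bound divides by \<open>\<eta> * \<beta>\<close>. If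
  \<open>\<beta>\<close> is 0, all \<open>y l\<close> vanish and the energy stays at
  \<open>Q \<ge> 0\<close>.\<close>
proof (cases "\<beta> = 0")
  case True
  then have "(\<Sum>l\<in>S. (y l)\<^sup>2) = 0" using y2 fin by (simp add: avg_def)
  then have "y l = 0" if "l \<in> S" for l
    using that fin(1) by (subst (asm) sum_nonneg_eq_0_iff) auto
  then have "avg S (\<lambda>l. max 0 (Q - 2 * \<eta> * (y l)\<^sup>2 + \<eta>\<^sup>2 * (y l)\<^sup>2 * s l)) = avg S (\<lambda>l. max 0 Q)"
    by (intro avg_cong) simp
  then show ?thesis using True Q fin by (simp add: avg_const)
next
  case False
  have "0 \<le> \<beta>" unfolding y2[symmetric] by (rule avg_nonneg) simp
  with False have \<beta>: "0 < \<beta>" by simp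
  let ?D = "\<eta> * \<beta>"
  have D: "0 < ?D" using eta \<beta> by simp
  have "avg S (\<lambda>l. max 0 (Q - 2 * \<eta> * (y l)\<^sup>2 + \<eta>\<^sup>2 * (y l)\<^sup>2 * s l))
    \<le> avg S (\<lambda>l. Q - \<eta> / 9 * (y l)\<^sup>2 + \<eta>\<^sup>2 / (162 * ?D) * (y l)^4 + \<eta>^3 * ((s l)\<^sup>2 * (y l)\<^sup>2))"
  proof (rule avg_mono)
    fix l
    have "0 \<le> \<eta> * (y l)\<^sup>2" using eta by simp
    from truncated_energy_le[OF D Q this, of "\<eta> * s l"] eta
    show "max 0 (Q - 2 * \<eta> * (y l)\<^sup>2 + \<eta>\<^sup>2 * (y l)\<^sup>2 * s l)
      \<le> Q - \<eta> / 9 * (y l)\<^sup>2 + \<eta>\<^sup>2 / (162 * ?D) * (y l)^4 + \<eta>^3 * ((s l)\<^sup>2 * (y l)\<^sup>2)"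
      by (simp add: power2_eq_square power3_eq_cube power4_eq_xxxx mult_ac)
  qed
  also have "\<dots> = Q - \<eta> / 9 * \<beta> + \<eta>\<^sup>2 / (162 * ?D) * avg S (\<lambda>l. (y l)^4)
      + \<eta>^3 * avg S (\<lambda>l. (s l)\<^sup>2 * (y l)\<^sup>2)"
    unfolding avg_add avg_diff avg_cmult y2 avg_const[OF fin] ..
  also have "\<dots> \<le> Q - \<eta> / 9 * \<beta> + \<eta>\<^sup>2 / (162 * ?D) * (9 * \<beta>\<^sup>2) + \<eta>^3 * (27 * V * \<beta>)"
    using eta \<beta> by (intro add_mono mult_left_mono y4 sy order_refl) auto
  also have "\<dots> = Q - \<eta> * \<beta> / 18 + 27 * (\<eta>\<^sup>2 * V) * (\<eta> * \<beta>)"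
    using eta \<beta> by (simp add: power2_eq_square power3_eq_cube)
  also have "\<dots> \<le> Q - \<eta> * \<beta> / 18 + 27 * (1 / 972) * (\<eta> * \<beta>)"
    using D small by (intro add_left_mono mult_right_mono mult_left_mono) auto
  also have "\<dots> = Q - \<eta> * \<beta> / 36" by simp
  finally show ?thesis .
qed

lemma scalar_prod_vec_of_list:
  assumes "length l = d" "b \<in> carrier_vec d"
  shows "scalar_prod (vec_of_list l) b = lin_form (\<lambda>i. b $ i) l"
  using assms by (auto simp: scalar_prod_def lin_form_def atLeast0LessThan vec_of_list_index intro!: sum.cong)

lemma vec_of_list_in_carrier [simp]: "length l = d \<Longrightarrow> vec_of_list l \<in> carrier_vec d"
  by (intro carrier_vecI) simp

lemma sign_lists_carrier [simp]: "l \<in> sign_lists d \<Longrightarrow> vec_of_list l \<in> carrier_vec d"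
  by (simp add: length_sign_lists)

section \<open>Moments of the random forms and the effect of one step\<close>

locale symmetric_matrix =
  fixes d :: nat and A :: "real mat"
  assumes A: "A \<in> sym_mats d"
begin

lemma A_carrier [simp]: "A \<in> carrier_mat d d" and A_transpose: "transpose_mat A = A"
  using A by (auto simp: sym_mats_def)

lemma A_mult_carrier [simp]: "x \<in> carrier_vec d \<Longrightarrow> A *\<^sub>v x \<in> carrier_vec d"
  by (rule mult_mat_vec_carrier[OF A_carrier])

abbreviation E :: "(real list \<Rightarrow> real) \<Rightarrow> real" where
  "E \<equiv> avg (sign_lists d)"

definition energy :: "real vec \<Rightarrow> real" where
  "energy x = scalar_prod x (A *\<^sub>v x)"

definition form_at :: "real vec \<Rightarrow> real list \<Rightarrow> real" where
  "form_at b l = scalar_prod (vec_of_list l) b"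

definition energy_at :: "real list \<Rightarrow> real" where
  "energy_at l = energy (vec_of_list l)"

text \<open>The mean square of \<open>g^T A g\<close>, against which the step size must be small.
  The tester does not know it and sees a single sample of \<open>g^T A g\<close> instead.\<close>

definition scale :: real where
  "scale = E (\<lambda>l. (energy_at l)\<^sup>2)"

lemma form_at_eq: "b \<in> carrier_vec d \<Longrightarrow> l \<in> sign_lists d \<Longrightarrow> form_at b l = lin_form (\<lambda>i. b $ i) l"
  unfolding form_at_def by (intro scalar_prod_vec_of_list) (simp_all add: length_sign_lists)

lemma energy_at_eq:
  assumes "l \<in> sign_lists d"
  shows "energy_at l = quad_form (\<lambda>i j. A $$ (i, j)) l"
proof -
  have l: "length l = d" by (rule length_sign_lists[OF assms])
  have "energy_at l = lin_form (\<lambda>i. (A *\<^sub>v vec_of_list l) $ i) l"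
    unfolding energy_at_def energy_def by (rule scalar_prod_vec_of_list[OF l]) (simp add: l)
  also have "\<dots> = (\<Sum>i<d. (\<Sum>j<d. A $$ (i, j) * l ! j) * l ! i)"
  proof -
    have "(A *\<^sub>v vec_of_list l) $ i = (\<Sum>j<d. A $$ (i, j) * l ! j)" if "i < d" for i
      using that l carrier_matD[OF A_carrier]
      by (simp add: scalar_prod_def atLeast0LessThan vec_of_list_index)
    then show ?thesis by (simp add: lin_form_def l)
  qed
  finally show ?thesis by (simp add: quad_form_def l sum_distrib_left sum_distrib_right mult_ac)
qed

lemma scalar_prod_sum_lessThan:
  "b \<in> carrier_vec d \<Longrightarrow> scalar_prod a b = (\<Sum>i<d. a $ i * b $ i)"
  by (auto simp: scalar_prod_def atLeast0LessThan)

lemma avg_form_mult: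
  assumes "b \<in> carrier_vec d" "c \<in> carrier_vec d"
  shows "E (\<lambda>l. form_at b l * form_at c l) = scalar_prod b c"
proof -
  have "E (\<lambda>l. form_at b l * form_at c l)
      = E (\<lambda>l. (0 + lin_form (\<lambda>i. b $ i) l) * (0 + lin_form (\<lambda>i. c $ i) l))"
    by (intro avg_cong) (simp add: form_at_eq assms)
  then show ?thesis unfolding avg_lin_form_mult using assms by (simp add: scalar_prod_sum_lessThan)
qed

lemma avg_form_square:
  assumes "b \<in> carrier_vec d"
  shows "E (\<lambda>l. (form_at b l)\<^sup>2) = scalar_prod b b"
  using avg_form_mult[OF assms assms] by (simp add: power2_eq_square)

lemma norm_square_nonneg: "b \<in> carrier_vec d \<Longrightarrow> 0 \<le> scalar_prod b b" for b :: "real vec"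
  by (auto simp: scalar_prod_sum_lessThan intro!: sum_nonneg)

text \<open>Inherited from averages, because the random forms of \<open>b\<close> and
  \<open>c\<close> have correlation \<open>scalar_prod b c\<close>.\<close>

lemma scalar_prod_Cauchy_Schwarz:
  fixes b c :: "real vec"
  assumes "b \<in> carrier_vec d" "c \<in> carrier_vec d"
  shows "(scalar_prod b c)\<^sup>2 \<le> scalar_prod b b * scalar_prod c c"
  using avg_Cauchy_Schwarz[of "sign_lists d" "form_at b" "form_at c"]
  by (simp add: avg_form_mult avg_form_square assms)

lemma avg_form_fourth:
  assumes b: "b \<in> carrier_vec d"
  shows "E (\<lambda>l. (form_at b l)^4) \<le> 9 * (scalar_prod b b)\<^sup>2"
proof -
  have "E (\<lambda>l. (form_at b l)^4) = E (\<lambda>l. (0 + lin_form (\<lambda>i. b $ i) l)^4)"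
    by (intro avg_cong) (simp add: form_at_eq b)
  also have "\<dots> \<le> 9^1 * (E (\<lambda>l. (0 + lin_form (\<lambda>i. b $ i) l)\<^sup>2))\<^sup>2"
    by (intro sign_poly_hypercontractive sign_poly_lin_form)
  also have "E (\<lambda>l. (0 + lin_form (\<lambda>i. b $ i) l)\<^sup>2) = E (\<lambda>l. (form_at b l)\<^sup>2)"
    by (intro avg_cong) (simp add: form_at_eq b)
  finally show ?thesis by (simp add: avg_form_square b)
qed

lemma avg_energy_fourth: "E (\<lambda>l. (energy_at l)^4) \<le> 81 * scale\<^sup>2"
proof -
  let ?q = "\<lambda>l. 0 + quad_form (\<lambda>i j. A $$ (i, j)) l"
  have "E (\<lambda>l. (energy_at l)^4) = E (\<lambda>l. (?q l)^4)"
    by (intro avg_cong) (simp add: energy_at_eq)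
  also have "\<dots> \<le> 9^2 * (E (\<lambda>l. (?q l)\<^sup>2))\<^sup>2"
    by (intro sign_poly_hypercontractive sign_poly_quad_form)
  also have "E (\<lambda>l. (?q l)\<^sup>2) = scale"
    unfolding scale_def by (intro avg_cong) (simp add: energy_at_eq)
  finally show ?thesis by simp
qed

lemma scale_nonneg: "0 \<le> scale"
  unfolding scale_def by (intro avg_nonneg) simp

lemma avg_form_square_mult:
  assumes "b \<in> carrier_vec d" "c \<in> carrier_vec d"
  shows "E (\<lambda>l. (form_at b l)\<^sup>2 * (form_at c l)\<^sup>2) \<le> 9 * scalar_prod b b * scalar_prod c c"
proof (rule power2_le_imp_le)
  have "(E (\<lambda>l. (form_at b l)\<^sup>2 * (form_at c l)\<^sup>2))\<^sup>2 \<le> E (\<lambda>l. (form_at b l)^4) * E (\<lambda>l. (form_at c l)^4)"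
    unfolding fourth_power_square by (rule avg_Cauchy_Schwarz)
  also have "\<dots> \<le> (9 * (scalar_prod b b)\<^sup>2) * (9 * (scalar_prod c c)\<^sup>2)"
    by (intro mult_mono avg_form_fourth assms avg_nonneg) auto
  finally show "(E (\<lambda>l. (form_at b l)\<^sup>2 * (form_at c l)\<^sup>2))\<^sup>2 \<le> (9 * scalar_prod b b * scalar_prod c c)\<^sup>2"
    by (simp add: power_mult_distrib)
qed (use assms norm_square_nonneg in auto)

text \<open>Degree 2 and degree 1 hypercontractivity, combined by Cauchy-Schwarz: 27 is the root of
  81 * 9. This is the curvature hypothesis of \<open>descent_decreases\<close>.\<close>

lemma avg_energy_square_form:
  assumes "b \<in> carrier_vec d"
  shows "E (\<lambda>l. (energy_at l)\<^sup>2 * (form_at b l)\<^sup>2) \<le> 27 * scale * scalar_prod b b"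
proof (rule power2_le_imp_le)
  have "(E (\<lambda>l. (energy_at l)\<^sup>2 * (form_at b l)\<^sup>2))\<^sup>2 \<le> E (\<lambda>l. (energy_at l)^4) * E (\<lambda>l. (form_at b l)^4)"
    unfolding fourth_power_square by (rule avg_Cauchy_Schwarz)
  also have "\<dots> \<le> (81 * scale\<^sup>2) * (9 * (scalar_prod b b)\<^sup>2)"
    by (intro mult_mono avg_form_fourth avg_energy_fourth assms avg_nonneg) auto
  finally show "(E (\<lambda>l. (energy_at l)\<^sup>2 * (form_at b l)\<^sup>2))\<^sup>2 \<le> (27 * scale * scalar_prod b b)\<^sup>2"
    by (simp add: power_mult_distrib)
qed (use assms norm_square_nonneg scale_nonneg in auto)

text \<open>The squared trace contributes 1 and twice the squared Frobenius norm contributes 2. This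
  is how the trace norm enters the choice of step size.\<close>

lemma scale_le: "scale \<le> 3 * (schatten_norm 1 A)\<^sup>2"
proof -
  let ?t = "\<Sum>i<d. A $$ (i, i)"
  have "scale = E (\<lambda>l. (0 + quad_form (\<lambda>i j. A $$ (i, j)) l)\<^sup>2)"
    unfolding scale_def by (intro avg_cong) (simp add: energy_at_eq)
  also have "\<dots> \<le> ?t\<^sup>2 + 2 * (\<Sum>i<d. \<Sum>j<d. (A $$ (i, j))\<^sup>2)"
    using avg_quad_form_square_le[where c = 0] by simp
  also have "?t\<^sup>2 \<le> (schatten_norm 1 A)\<^sup>2"
    using symmetric_schatten_1_bounds(1)[OF A] by (intro abs_le_square_iff[THEN iffD1]) simp
  finally show ?thesis using symmetric_schatten_1_bounds(2)[OF A] by simp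
qed

lemma A_symmetric:
  assumes "x \<in> carrier_vec d" "y \<in> carrier_vec d"
  shows "scalar_prod (A *\<^sub>v x) y = scalar_prod x (A *\<^sub>v y)"
  using transpose_vec_mult_scalar[OF A_carrier assms(2,1)] A_transpose by simp

definition descent_step :: "real \<Rightarrow> real vec \<Rightarrow> real vec \<Rightarrow> real vec" where
  "descent_step \<eta> x g = x - (\<eta> * scalar_prod g (A *\<^sub>v x)) \<cdot>\<^sub>v g"

lemma descent_step_carrier:
  "x \<in> carrier_vec d \<Longrightarrow> g \<in> carrier_vec d \<Longrightarrow> descent_step \<eta> x g \<in> carrier_vec d"
  by (simp add: descent_step_def)

text \<open>Symmetry merges the two cross terms. For positive \<open>\<eta>\<close> only the
  curvature term, the last one, can raise the energy.\<close>

lemma energy_descent_step: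
  assumes "x \<in> carrier_vec d" "l \<in> sign_lists d"
  shows "energy (descent_step \<eta> x (vec_of_list l)) =
    energy x - 2 * \<eta> * (form_at (A *\<^sub>v x) l)\<^sup>2 + \<eta>\<^sup>2 * (form_at (A *\<^sub>v x) l)\<^sup>2 * energy_at l"
proof -
  let ?g = "vec_of_list l" and ?y = "form_at (A *\<^sub>v x) l"
  have g: "?g \<in> carrier_vec d" using assms by simp
  note [simp] = assms(1) g
  have y: "scalar_prod ?g (A *\<^sub>v x) = ?y" by (simp add: form_at_def)
  have y': "scalar_prod x (A *\<^sub>v ?g) = ?y"
    using A_symmetric[of x ?g] by (subst y[symmetric]) (simp add: comm_scalar_prod[of _ d])
  have "A *\<^sub>v (x - (\<eta> * ?y) \<cdot>\<^sub>v ?g) = A *\<^sub>v x - (\<eta> * ?y) \<cdot>\<^sub>v (A *\<^sub>v ?g)"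
    by (simp add: mult_minus_distrib_mat_vec[OF A_carrier] mult_mat_vec[OF A_carrier])
  then have "energy (descent_step \<eta> x ?g) =
      scalar_prod (x - (\<eta> * ?y) \<cdot>\<^sub>v ?g) (A *\<^sub>v x - (\<eta> * ?y) \<cdot>\<^sub>v (A *\<^sub>v ?g))"
    by (simp add: energy_def descent_step_def y)
  also have "\<dots> = energy x - (\<eta> * ?y) * ?y - (\<eta> * ?y) * (?y - (\<eta> * ?y) * energy_at l)"
    by (simp add: minus_scalar_prod_distrib[of _ d] scalar_prod_minus_distrib[of _ d]
        smult_scalar_prod_distrib[of _ d] scalar_prod_smult_distrib[of _ d] energy_def
        energy_at_def y y')
  finally show ?thesis by (simp add: power2_eq_square algebra_simps)
qed

lemma scalar_prod_descent_step:
  assumes "x \<in> carrier_vec d" "v \<in> carrier_vec d" "l \<in> sign_lists d"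
  shows "scalar_prod (descent_step \<eta> x (vec_of_list l)) v =
    scalar_prod x v - \<eta> * (form_at (A *\<^sub>v x) l * form_at v l)"
  using assms
  by (simp add: descent_step_def form_at_def minus_scalar_prod_distrib[of _ d]
      smult_scalar_prod_distrib[of _ d])

end

section \<open>The tester\<close>

text \<open>The only rejecting leaf follows a negative answer to a query \<open>x'^T A x'\<close>,
  which certifies that the matrix is not PSD.\<close>

primrec descent :: "real \<Rightarrow> real vec list \<Rightarrow> real vec \<Rightarrow> query_tree" where
  "descent \<eta> [] x = Output True"
| "descent \<eta> (g # gs) x = Query g x (\<lambda>y. let x' = x - (\<eta> * y) \<cdot>\<^sub>v g in
     Query x' x' (\<lambda>q. if q < 0 then Output False else descent \<eta> gs x'))"

text \<open>The value at 0 matters only if all sign vectors have energy 0; then any positive step works.\<close>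

definition step_size :: "real \<Rightarrow> real" where
  "step_size s = (if s = 0 then 1 else 1 / (2000000 * s))"

text \<open>The vector \<open>h\<close> is used only to guess the scale for the step size. Rejecting
  on negative \<open>s\<close> ensures a positive step; testing \<open>x\<close> ensures that the
  descent starts with nonnegative energy.\<close>

definition trial :: "real vec \<Rightarrow> real vec \<Rightarrow> real vec list \<Rightarrow> query_tree" where
  "trial h x gs = Query h h (\<lambda>s. if s < 0 then Output False else
     Query x x (\<lambda>q. if q < 0 then Output False else descent (step_size s) gs x))"

text \<open>Sequential conjunction: a rejection by the first tree ends the run.\<close>

primrec both :: "query_tree \<Rightarrow> query_tree \<Rightarrow> query_tree" where
  "both (Output b) t = (if b then t else Output False)"
| "both (Query v w f) t = Query v w (\<lambda>r. both (f r) t)"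

lemma run_both: "run A (both t u) \<longleftrightarrow> run A t \<and> run A u"
  by (induction t) auto

lemma num_queries_both: "num_queries A (both t u) \<le> num_queries A t + num_queries A u"
  by (induction t) auto

lemma queries_in_dim_both: "queries_in_dim d t \<Longrightarrow> queries_in_dim d u \<Longrightarrow> queries_in_dim d (both t u)"
  by (induction t) auto

definition conjunction :: "query_tree list \<Rightarrow> query_tree" where
  "conjunction ts = foldr both ts (Output True)"

lemma run_conjunction: "run A (conjunction ts) \<longleftrightarrow> (\<forall>t \<in> set ts. run A t)"
  by (induction ts) (auto simp: conjunction_def run_both)

lemma num_queries_conjunction:
  assumes "\<And>t. t \<in> set ts \<Longrightarrow> num_queries A t \<le> m"
  shows "num_queries A (conjunction ts) \<le> length ts * m"
  using assms
proof (induction ts)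
  case (Cons t ts)
  have "num_queries A (conjunction (t # ts)) \<le> num_queries A t + num_queries A (conjunction ts)"
    by (simp add: conjunction_def num_queries_both)
  then show ?case using Cons by fastforce
qed (simp add: conjunction_def)

lemma queries_in_dim_conjunction:
  "(\<And>t. t \<in> set ts \<Longrightarrow> queries_in_dim d t) \<Longrightarrow> queries_in_dim d (conjunction ts)"
  by (induction ts) (auto simp: conjunction_def queries_in_dim_both)

lemma num_queries_descent: "num_queries A (descent \<eta> gs x) \<le> 2 * length gs"
proof (induction gs arbitrary: x)
  case (Cons g gs)
  have "num_queries A (descent \<eta> gs y) \<le> 2 * length gs" for y by (rule Cons)
  then show ?case by (simp add: Let_def)
qed simp

lemma num_queries_trial: "num_queries A (trial h x gs) \<le> 2 * length gs + 2"
  using num_queries_descent by (simp add: trial_def)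

lemma queries_in_dim_descent:
  "x \<in> carrier_vec d \<Longrightarrow> set gs \<subseteq> carrier_vec d \<Longrightarrow> queries_in_dim d (descent \<eta> gs x)"
  by (induction gs arbitrary: x) (auto simp: Let_def)

lemma queries_in_dim_trial:
  "h \<in> carrier_vec d \<Longrightarrow> x \<in> carrier_vec d \<Longrightarrow> set gs \<subseteq> carrier_vec d \<Longrightarrow>
    queries_in_dim d (trial h x gs)"
  by (simp add: trial_def queries_in_dim_descent)

lemma psd_run_descent:
  assumes "psd d A"
  shows "x \<in> carrier_vec d \<Longrightarrow> set gs \<subseteq> carrier_vec d \<Longrightarrow> run A (descent \<eta> gs x)"
proof (induction gs arbitrary: x)
  case (Cons g gs)
  have "x - c \<cdot>\<^sub>v g \<in> carrier_vec d" for c using Cons.prems by simp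
  then show ?case using Cons assms by (auto simp: Let_def psd_def not_less)
qed simp

lemma psd_run_trial:
  assumes "psd d A" "h \<in> carrier_vec d" "x \<in> carrier_vec d" "set gs \<subseteq> carrier_vec d"
  shows "run A (trial h x gs)"
  using assms psd_run_descent[OF assms(1)] by (auto simp: trial_def psd_def not_less)

text \<open>Used to peel off the random choices of a trial one at a time: a good choice, made with
  probability at least \<open>p\<close>, leaves failure probability at least
  \<open>q\<close>.\<close>

lemma avg_le_one_minus:
  assumes "finite S" "S \<noteq> {}" "\<And>x. x \<in> S \<Longrightarrow> f x \<le> 1" "\<And>x. x \<in> S \<Longrightarrow> P x \<Longrightarrow> f x \<le> 1 - q"
    and "0 \<le> q" "p \<le> avg S (\<lambda>x. of_bool (P x))"
  shows "avg S f \<le> 1 - p * q"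
proof -
  have "avg S f \<le> avg S (\<lambda>x. 1 - q * of_bool (P x))"
    using assms(3,4) by (intro avg_mono) auto
  also have "\<dots> = 1 - q * avg S (\<lambda>x. of_bool (P x))"
    by (simp add: avg_diff avg_cmult avg_const assms(1,2))
  also have "\<dots> \<le> 1 - q * p" using assms(5,6) by (simp add: mult_left_mono)
  finally show ?thesis by (simp add: mult.commute)
qed

section \<open>Survival of the descent from a given point\<close>

context symmetric_matrix
begin

definition survival :: "real \<Rightarrow> nat \<Rightarrow> real vec \<Rightarrow> real" where
  "survival \<eta> n x =
     avg (lists_of_length (sign_lists d) n) (\<lambda>ls. of_bool (run A (descent \<eta> (map vec_of_list ls) x)))"

text \<open>Conditioning on the first direction: the remaining directions are fresh, so only the new
  point matters.\<close>

lemma survival_Suc: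
  "survival \<eta> (Suc n) x = E (\<lambda>l. let x' = descent_step \<eta> x (vec_of_list l) in
     if energy x' < 0 then 0 else survival \<eta> n x')"
  unfolding survival_def avg_lists_of_length_Suc
  by (intro avg_cong) (simp add: Let_def descent_step_def energy_def
      avg_const[OF finite_lists_of_length[OF finite_sign_lists] lists_of_length_nonempty[OF sign_lists_nonempty]])

lemma survival_le_1: "survival \<eta> n x \<le> 1"
proof -
  have "survival \<eta> n x \<le> avg (lists_of_length (sign_lists d) n) (\<lambda>_. 1)"
    unfolding survival_def by (intro avg_mono) simp
  then show ?thesis
    by (simp add: avg_const finite_lists_of_length finite_sign_lists lists_of_length_nonempty sign_lists_nonempty)
qed

text \<open>The first step alone already rejects often enough; the later ones are bounded by
  1.\<close>

lemma survival_large_gradient: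
  assumes x: "x \<in> carrier_vec d" and eta: "0 < \<eta>" "\<eta>\<^sup>2 * scale \<le> 1 / 972"
    and Q: "0 \<le> energy x" "2 * energy x < \<eta> * scalar_prod (A *\<^sub>v x) (A *\<^sub>v x)"
  shows "survival \<eta> (Suc n) x \<le> 71 / 72"
proof -
  let ?x = "\<lambda>l. descent_step \<eta> x (vec_of_list l)"
  have Ax: "A *\<^sub>v x \<in> carrier_vec d" using x by simp
  have "survival \<eta> (Suc n) x \<le> E (\<lambda>l. 1 - of_bool (energy (?x l) < 0))"
    unfolding survival_Suc by (intro avg_mono) (auto simp: Let_def survival_le_1)
  also have "\<dots> = 1 - E (\<lambda>l. of_bool (energy (?x l) < 0))"
    by (simp add: avg_diff avg_sign_const)
  also have "E (\<lambda>l. of_bool (energy (?x l) < 0)) = E (\<lambda>l. of_bool (energy x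
      - 2 * \<eta> * (form_at (A *\<^sub>v x) l)\<^sup>2 + \<eta>\<^sup>2 * (form_at (A *\<^sub>v x) l)\<^sup>2 * energy_at l < 0))"
    by (intro avg_cong) (simp add: energy_descent_step x)
  also have "1 - \<dots> \<le> 1 - 1 / 72"
    by (intro diff_left_mono descent_succeeds[OF finite_sign_lists sign_lists_nonempty eta
          avg_form_square[OF Ax] avg_form_fourth[OF Ax] _ Q]) (simp add: scale_def)
  finally show ?thesis by simp
qed

text \<open>The component of \<open>A x\<close> along the unit vector \<open>v\<close> is
  \<open>- \<mu>\<close> times that of \<open>x\<close>.\<close>

lemma gradient_ge:
  assumes v: "v \<in> carrier_vec d" "scalar_prod v v = 1" "A *\<^sub>v v = (- \<mu>) \<cdot>\<^sub>v v"
    and x: "x \<in> carrier_vec d"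
  shows "\<mu>\<^sup>2 * (scalar_prod x v)\<^sup>2 \<le> scalar_prod (A *\<^sub>v x) (A *\<^sub>v x)"
proof -
  have "scalar_prod (A *\<^sub>v x) v = - \<mu> * scalar_prod x v"
    using A_symmetric[OF x v(1)] v x by simp
  then show ?thesis
    using scalar_prod_Cauchy_Schwarz[of "A *\<^sub>v x" v] v x by (simp add: power_mult_distrib)
qed

text \<open>As long as the energy is large compared to the gradient, the right-hand side is a
  supermartingale: the drift multiplies \<open>u = scalar_prod x v\<close> by \<open>\<rho>\<close> in each step, and the
  variance this produces is paid for by the expected loss of energy.\<close>

lemma survival_bound:
  assumes eta: "0 < \<eta>" "\<eta>\<^sup>2 * scale \<le> 1 / 972"
    and v: "v \<in> carrier_vec d" "scalar_prod v v = 1" "A *\<^sub>v v = (- \<mu>) \<cdot>\<^sub>v v" and lam: "0 < \<mu>"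
    and rho: "\<rho> = 1 + \<eta> * \<mu>" and L: "L \<noteq> 0"
    and G0: "0 \<le> G" and G: "324 * \<eta> * (\<rho>^N)\<^sup>2 \<le> G * L\<^sup>2" "1 \<le> 9 * G * \<eta> * \<mu>\<^sup>2 * L\<^sup>2"
  shows "n \<le> N \<Longrightarrow> x \<in> carrier_vec d \<Longrightarrow> 0 \<le> energy x \<Longrightarrow>
    survival \<eta> (Suc n) x \<le> 71 / 72 + (1 - scalar_prod x v * \<rho>^n / L)\<^sup>2 + G * energy x"
proof (induction n arbitrary: x)
  case (0 x)
  let ?u = "scalar_prod x v" and ?\<beta> = "scalar_prod (A *\<^sub>v x) (A *\<^sub>v x)"
  show ?case
  \<comment> \<open>The bound speaks of \<open>Suc n\<close> steps so that one step is left even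
    here, which the large-gradient case needs.\<close>
  proof (cases "2 * energy x < \<eta> * ?\<beta>")
    case True
    then have "survival \<eta> (Suc 0) x \<le> 71 / 72"
      by (intro survival_large_gradient eta 0)
    moreover have "0 \<le> G * energy x" using G0 0 by simp
    ultimately show ?thesis by (smt (verit) zero_le_power2)
  next
    case False
    have "\<mu>\<^sup>2 * ?u\<^sup>2 \<le> ?\<beta>" by (rule gradient_ge[OF v 0(2)])
    then have "\<eta> * (\<mu>\<^sup>2 * ?u\<^sup>2) \<le> \<eta> * ?\<beta>" using eta by (intro mult_left_mono) auto
    then have e: "\<eta> * \<mu>\<^sup>2 * ?u\<^sup>2 / 2 \<le> energy x" using False by simp
    \<comment> \<open>The right-hand side must reach the trivial bound 1. Either \<open>u\<close> is
      far from \<open>L\<close>, and the square is at least 1/4, or \<open>u\<close> is large, and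
      then the gradient and hence the energy is large; the 9 in \<open>G(2)\<close> is 72 /
      8.\<close>
    have "1 / 72 \<le> (1 - ?u / L)\<^sup>2 + G * energy x"
    proof (cases "?u / L \<le> 1 / 2")
      case True
      then have "(1 / 2)\<^sup>2 \<le> (1 - ?u / L)\<^sup>2" by (intro power_mono) auto
      moreover have "0 \<le> G * energy x" using G0 0 by simp
      moreover have "(1 / 2)\<^sup>2 = (1 / 4 :: real)" by (simp add: power2_eq_square)
      ultimately show ?thesis by linarith
    next
      case False
      then have "(1 / 2)\<^sup>2 \<le> (?u / L)\<^sup>2" by (intro power_mono) auto
      then have "L\<^sup>2 / 4 \<le> ?u\<^sup>2" using L by (simp add: power_divide field_simps)
      then have "\<eta> * \<mu>\<^sup>2 * (L\<^sup>2 / 4) \<le> \<eta> * \<mu>\<^sup>2 * ?u\<^sup>2" using eta by (intro mult_left_mono) auto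
      then have "\<eta> * \<mu>\<^sup>2 * L\<^sup>2 / 8 \<le> energy x" using e by simp
      then have "G * (\<eta> * \<mu>\<^sup>2 * L\<^sup>2 / 8) \<le> G * energy x" using G0 by (rule mult_left_mono)
      moreover have "1 / 72 \<le> G * (\<eta> * \<mu>\<^sup>2 * L\<^sup>2 / 8)" using G(2) by (simp add: mult_ac)
      ultimately show ?thesis using zero_le_power2[of "1 - ?u / L"] by linarith
    qed
    then show ?thesis using survival_le_1[of \<eta> "Suc 0" x] by simp
  qed
next
  case (Suc k x)
  note x = Suc.prems(2)
  let ?u = "scalar_prod x v" and ?b = "A *\<^sub>v x"
  let ?\<beta> = "scalar_prod ?b ?b"
  have Ax: "?b \<in> carrier_vec d" using x by simp
  show ?case
  proof (cases "2 * energy x < \<eta> * ?\<beta>")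
    case True
    then have "survival \<eta> (Suc (Suc k)) x \<le> 71 / 72"
      by (intro survival_large_gradient eta Suc)
    moreover have "0 \<le> G * energy x" using G0 Suc by simp
    ultimately show ?thesis by (smt (verit) zero_le_power2)
  next
    case False
    let ?x = "\<lambda>l. descent_step \<eta> x (vec_of_list l)"
    \<comment> \<open>The factor of the induction hypothesis, applied at the new point. The drift of
      this step turns it into \<open>\<rho> * c\<close>.\<close>
    define c where "c = \<rho>^k / L"
    let ?w = "\<lambda>l. form_at ?b l * form_at v l"
    have bv: "scalar_prod ?b v = - \<mu> * ?u"
      using A_symmetric[OF x v(1)] v x by simp
    have rho1: "1 \<le> \<rho>" using eta lam by (simp add: rho)
    have "324 * \<eta> * (\<rho>^k)\<^sup>2 \<le> 324 * \<eta> * (\<rho>^N)\<^sup>2"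
      using Suc.prems(1) rho1 eta by (intro mult_left_mono power_mono power_increasing) auto
    then have "324 * \<eta> * (\<rho>^k)\<^sup>2 \<le> G * L\<^sup>2" using G(1) by linarith
    then have Gc: "324 * \<eta> * c\<^sup>2 \<le> G"
      using L by (simp add: c_def power_divide pos_divide_le_eq)
    \<comment> \<open>Rejected branches survive with probability 0, so \<open>max 0\<close> may
      replace their negative energy.\<close>
    have "survival \<eta> (Suc (Suc k)) x
      \<le> E (\<lambda>l. 71 / 72 + (1 - scalar_prod (?x l) v * c)\<^sup>2 + G * max 0 (energy (?x l)))"
      unfolding survival_Suc[of \<eta> "Suc k"]
    proof (rule avg_mono)
      fix l assume l: "l \<in> sign_lists d"
      have xl: "?x l \<in> carrier_vec d"
        using l by (intro descent_step_carrier x) simp_all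
      show "(let x' = ?x l in if energy x' < 0 then 0 else survival \<eta> (Suc k) x')
        \<le> 71 / 72 + (1 - scalar_prod (?x l) v * c)\<^sup>2 + G * max 0 (energy (?x l))"
      proof (cases "energy (?x l) < 0")
        case True
        then show ?thesis by (simp add: Let_def)
      next
        case False
        then show ?thesis
          using Suc.IH[OF _ xl] Suc.prems(1) by (simp add: Let_def c_def)
      qed
    qed
    also have "\<dots> = 71 / 72 + E (\<lambda>l. (1 - scalar_prod (?x l) v * c)\<^sup>2) + G * E (\<lambda>l. max 0 (energy (?x l)))"
      by (simp add: avg_add avg_cmult avg_sign_const)
    also have "E (\<lambda>l. (1 - scalar_prod (?x l) v * c)\<^sup>2)
       = E (\<lambda>l. (1 - ?u * c)\<^sup>2 + (2 * (1 - ?u * c) * c * \<eta>) * ?w l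
           + (c\<^sup>2 * \<eta>\<^sup>2) * ((form_at ?b l)\<^sup>2 * (form_at v l)\<^sup>2))"
      by (intro avg_cong) (simp add: scalar_prod_descent_step x v power2_eq_square algebra_simps)
    also have "\<dots> = (1 - ?u * c)\<^sup>2 + (2 * (1 - ?u * c) * c * \<eta>) * (- \<mu> * ?u)
           + (c\<^sup>2 * \<eta>\<^sup>2) * E (\<lambda>l. (form_at ?b l)\<^sup>2 * (form_at v l)\<^sup>2)"
      unfolding avg_add avg_cmult avg_sign_const avg_form_mult[OF Ax v(1)] bv ..
    also have "E (\<lambda>l. max 0 (energy (?x l))) = E (\<lambda>l. max 0 (energy x
        - 2 * \<eta> * (form_at ?b l)\<^sup>2 + \<eta>\<^sup>2 * (form_at ?b l)\<^sup>2 * energy_at l))"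
      by (intro avg_cong) (simp add: energy_descent_step x)
    finally have main: "survival \<eta> (Suc (Suc k)) x \<le> 71 / 72 + ((1 - ?u * c)\<^sup>2
        + (2 * (1 - ?u * c) * c * \<eta>) * (- \<mu> * ?u)
        + (c\<^sup>2 * \<eta>\<^sup>2) * E (\<lambda>l. (form_at ?b l)\<^sup>2 * (form_at v l)\<^sup>2))
        + G * E (\<lambda>l. max 0 (energy x - 2 * \<eta> * (form_at ?b l)\<^sup>2 + \<eta>\<^sup>2 * (form_at ?b l)\<^sup>2 * energy_at l))" .
    have "E (\<lambda>l. max 0 (energy x - 2 * \<eta> * (form_at ?b l)\<^sup>2 + \<eta>\<^sup>2 * (form_at ?b l)\<^sup>2 * energy_at l))
        \<le> energy x - \<eta> * ?\<beta> / 36"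
      using False by (intro descent_decreases[OF finite_sign_lists sign_lists_nonempty eta
          avg_form_square[OF Ax] avg_form_fourth[OF Ax] avg_energy_square_form[OF Ax]]) simp
    then have m1: "G * E (\<lambda>l. max 0 (energy x - 2 * \<eta> * (form_at ?b l)\<^sup>2 + \<eta>\<^sup>2 * (form_at ?b l)\<^sup>2 * energy_at l))
        \<le> G * (energy x - \<eta> * ?\<beta> / 36)"
      using G0 by (rule mult_left_mono)
    have m2: "(c\<^sup>2 * \<eta>\<^sup>2) * E (\<lambda>l. (form_at ?b l)\<^sup>2 * (form_at v l)\<^sup>2) \<le> (c\<^sup>2 * \<eta>\<^sup>2) * (9 * ?\<beta>)"
      using avg_form_square_mult[OF Ax v(1)] v(2) by (intro mult_left_mono) auto
    \<comment> \<open>The expected energy loss pays for the variance: 324 is 9 from the mixed moment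
      times 36 from the guaranteed decrease.\<close>
    have "324 * \<eta> * c\<^sup>2 * (\<eta> * ?\<beta> / 36) \<le> G * (\<eta> * ?\<beta> / 36)"
      using Gc eta norm_square_nonneg[OF Ax] by (intro mult_right_mono) auto
    then have m3: "(c\<^sup>2 * \<eta>\<^sup>2) * (9 * ?\<beta>) + G * (energy x - \<eta> * ?\<beta> / 36) \<le> G * energy x"
      by (simp add: power2_eq_square algebra_simps)
    \<comment> \<open>The drift matches the linear part of the target exactly; the target has an
      additional nonnegative square.\<close>
    have r: "?u * \<rho>^Suc k / L = ?u * c + \<eta> * \<mu> * ?u * c"
      by (simp add: c_def rho algebra_simps add_divide_distrib)
    have "(1 - (z + t))\<^sup>2 = (1 - z)\<^sup>2 - 2 * (1 - z) * t + t\<^sup>2" for z t :: real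
      by (simp add: power2_eq_square algebra_simps)
    then have "(1 - ?u * \<rho>^Suc k / L)\<^sup>2
        = (1 - ?u * c)\<^sup>2 - 2 * (1 - ?u * c) * (\<eta> * \<mu> * ?u * c) + (\<eta> * \<mu> * ?u * c)\<^sup>2"
      unfolding r .
    moreover have "(2 * (1 - ?u * c) * c * \<eta>) * (- \<mu> * ?u) = - (2 * (1 - ?u * c) * (\<eta> * \<mu> * ?u * c))"
      by simp
    ultimately show ?thesis
      using main m1 m2 m3 zero_le_power2[of "\<eta> * \<mu> * ?u * c"] by linarith
  qed
qed

end

section \<open>Acceptance probability of one trial\<close>

lemma avg_of_bool_conj:
  "avg S (\<lambda>x. of_bool (P x)) - avg S (\<lambda>x. of_bool (\<not> Q x)) \<le> avg S (\<lambda>x. of_bool (P x \<and> Q x))"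
  unfolding avg_diff[symmetric] by (intro avg_mono) auto

context symmetric_matrix
begin

definition acceptance :: "nat \<Rightarrow> real" where
  "acceptance N = E (\<lambda>h. E (\<lambda>x. if energy_at h < 0 \<or> energy_at x < 0 then 0
     else survival (step_size (energy_at h)) (Suc N) (vec_of_list x)))"

text \<open>The squared correlation has mean 1 and second moment at most 9, so Paley-Zygmund gives
  1/(4 * 9).\<close>

lemma start_correlation:
  assumes "v \<in> carrier_vec d" "scalar_prod v v = 1"
  shows "1 / 36 \<le> E (\<lambda>l. of_bool (1 / 2 \<le> (form_at v l)\<^sup>2))"
  using paley_zygmund[OF finite_sign_lists sign_lists_nonempty, of d "\<lambda>l. (form_at v l)\<^sup>2" 9]
    avg_form_fourth[of v] avg_form_square[of v] assms by simp

lemma avg_energy_square_large: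
  assumes "0 < c" "0 < scale"
  shows "E (\<lambda>l. of_bool (\<not> (energy_at l)\<^sup>2 < c * scale)) \<le> 1 / c"
proof -
  have "E (\<lambda>l. of_bool (c * scale \<le> (energy_at l)\<^sup>2)) \<le> E (\<lambda>l. (energy_at l)\<^sup>2) / (c * scale)"
    using assms by (intro avg_markov) auto
  then show ?thesis using assms by (simp add: scale_def[symmetric] not_less)
qed

text \<open>Paley-Zygmund with the degree 2 constant 81 gives 1/324 for the lower bound; Markov's
  inequality at 648 removes at most half of that.\<close>

lemma avg_energy_square_typical:
  assumes "0 < scale"
  shows "1 / 648 \<le> E (\<lambda>l. of_bool (scale / 2 \<le> (energy_at l)\<^sup>2 \<and> (energy_at l)\<^sup>2 < 648 * scale))"
proof -
  have "1 / 324 \<le> E (\<lambda>l. of_bool (scale / 2 \<le> (energy_at l)\<^sup>2))"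
    using paley_zygmund[OF finite_sign_lists sign_lists_nonempty, of d "\<lambda>l. (energy_at l)\<^sup>2" 81]
      avg_energy_fourth assms by (simp add: scale_def)
  then show ?thesis
    using avg_energy_square_large[of 648] assms
      avg_of_bool_conj[of "sign_lists d" "\<lambda>l. scale / 2 \<le> (energy_at l)\<^sup>2" "\<lambda>l. (energy_at l)\<^sup>2 < 648 * scale"]
    by simp
qed

lemma schatten_1_nonneg: "0 \<le> schatten_norm 1 A"
  using symmetric_schatten_1_bounds(1)[OF A] by linarith

text \<open>A single sample \<open>s\<close> of the right magnitude yields a step that is small
  enough for \<open>survival_bound\<close> and still has \<open>\<eta> * \<mu>\<close> of order
  \<open>\<epsilon>\<close>, while the initial energy is affordable.\<close>

lemma survival_typical_start:
  assumes v: "v \<in> carrier_vec d" "scalar_prod v v = 1" "A *\<^sub>v v = (- \<mu>) \<cdot>\<^sub>v v"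
    and mu: "0 < \<mu>" "\<epsilon> * schatten_norm 1 A \<le> \<mu>" and eps: "0 < \<epsilon>"
    and N: "1 \<le> (1 + \<epsilon> / 10^8)^N * (\<epsilon> / 10^8)" and sc: "0 < scale"
    and s: "scale / 2 \<le> s\<^sup>2" "s\<^sup>2 < 648 * scale" "0 \<le> s"
    and x: "x \<in> carrier_vec d" "1 / 2 \<le> (scalar_prod x v)\<^sup>2"
    and Q: "(energy x)\<^sup>2 < 72 * scale" "0 \<le> energy x"
  shows "survival (step_size s) (Suc N) x \<le> 1 - 1 / 144"
proof -
  let ?n = "schatten_norm 1 A"
  define u where "u = scalar_prod x v"
  define \<eta> where "\<eta> = step_size s"
  define \<rho> where "\<rho> = 1 + \<eta> * \<mu>"
  \<comment> \<open>This target makes the squared term of \<open>survival_bound\<close> vanish at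
    the start, and \<open>G\<close> is the least value that its first condition allows. The second
    condition then reduces to the growth condition \<open>N\<close>.\<close>
  define L where "L = \<rho>^N * u"
  define G where "G = 324 * \<eta> / u\<^sup>2"
  have s0: "0 < s" using s sc by (cases "s = 0") auto
  have eta: "\<eta> = 1 / (2000000 * s)" "0 < \<eta>" using s0 by (auto simp: \<eta>_def step_size_def)
  have u2: "1 / 2 \<le> u\<^sup>2" using x by (simp add: u_def)
  have u0: "u \<noteq> 0" using u2 by auto
  have "243 * scale \<le> 1000000000000 * s\<^sup>2" using s(1) zero_le_power2[of s] by linarith
  then have small: "\<eta>\<^sup>2 * scale \<le> 1 / 972"
    using s0 by (simp add: eta(1) power_divide power_mult_distrib divide_simps)
  have "s\<^sup>2 < 648 * (3 * ?n\<^sup>2)" using s(2) scale_le by linarith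
  also have "\<dots> \<le> (45 * ?n)\<^sup>2" by (simp add: power_mult_distrib)
  finally have sn: "s < 45 * ?n" by (rule power_less_imp_less_base) (simp add: schatten_1_nonneg)
  \<comment> \<open>The constant comes from 45 * 2000000 = 9 * 10^7; here 45 covers the root of 648
    * 3.\<close>
  have "\<epsilon> / 10^8 \<le> \<eta> * \<mu>"
  proof -
    have "\<epsilon> * s \<le> \<epsilon> * (45 * ?n)" using sn eps by (intro mult_left_mono) auto
    also have "\<dots> \<le> 45 * \<mu>" using mu by simp
    finally show ?thesis using s0 mu by (simp add: eta(1) field_simps)
  qed
  then have "(1 + \<epsilon> / 10^8)^N * (\<epsilon> / 10^8) \<le> \<rho>^N * (\<eta> * \<mu>)"
    using eps eta(2) mu unfolding \<rho>_def by (intro mult_mono power_mono add_left_mono) auto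
  then have "1 \<le> \<rho>^N * (\<eta> * \<mu>)" using N by linarith
  then have gr: "1 \<le> (\<rho>^N * (\<eta> * \<mu>))\<^sup>2" by simp
  have rho0: "0 < \<rho>" using eta(2) mu by (simp add: \<rho>_def add_pos_pos)
  have L0: "L \<noteq> 0" using rho0 u0 by (simp add: L_def)
  have GL: "G * L\<^sup>2 = 324 * \<eta> * (\<rho>^N)\<^sup>2"
    using u0 by (simp add: G_def L_def power_mult_distrib)
  have "9 * G * \<eta> * \<mu>\<^sup>2 * L\<^sup>2 = 9 * \<eta> * \<mu>\<^sup>2 * (G * L\<^sup>2)" by (simp add: mult_ac)
  also have "\<dots> = 2916 * (\<rho>^N * (\<eta> * \<mu>))\<^sup>2"
    unfolding GL by (simp add: power2_eq_square mult_ac)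
  finally have G2: "1 \<le> 9 * G * \<eta> * \<mu>\<^sup>2 * L\<^sup>2" using gr by linarith
  have G0: "0 \<le> G" using eta(2) by (simp add: G_def)
  have "survival \<eta> (Suc N) x \<le> 71 / 72 + (1 - scalar_prod x v * \<rho>^N / L)\<^sup>2 + G * energy x"
    by (rule survival_bound[OF eta(2) small v mu(1) \<rho>_def L0 G0 _ G2 order_refl x(1) Q(2)])
      (simp add: GL)
  also have "scalar_prod x v * \<rho>^N / L = 1"
    using L0 by (simp add: L_def u_def)
  finally have b: "survival \<eta> (Suc N) x \<le> 71 / 72 + G * energy x" by simp
  \<comment> \<open>Since \<open>scale \<le> 2 * s^2\<close>, the initial energy is below
    \<open>12 * s\<close>. The factor 2000000 in the step size makes 648 * 12 / 2000000 less than
    1/144, half of the available 1/72.\<close>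
  have "(energy x)\<^sup>2 < (12 * s)\<^sup>2" using Q s by (simp add: power_mult_distrib)
  then have "energy x < 12 * s" by (rule power_less_imp_less_base) (simp add: s)
  then have e1: "\<eta> * energy x \<le> 12 / 2000000"
    using s0 by (simp add: eta(1) field_simps)
  have "1 / u\<^sup>2 \<le> 2" using u2 u0 by (simp add: field_simps)
  then have "324 * (\<eta> * energy x) * (1 / u\<^sup>2) \<le> 324 * (\<eta> * energy x) * 2"
    using eta(2) Q by (intro mult_left_mono) auto
  then have "G * energy x \<le> 648 * (\<eta> * energy x)" by (simp add: G_def)
  then show ?thesis using b e1 unfolding \<eta>_def by simp
qed

text \<open>The factors are the probabilities of a typical \<open>h\<close>, of a start correlated
  with \<open>v\<close> but of moderate energy (1/36 - 1/72), and of a rejecting descent.\<close>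

lemma acceptance_le:
  assumes v: "v \<in> carrier_vec d" "scalar_prod v v = 1" "A *\<^sub>v v = (- \<mu>) \<cdot>\<^sub>v v"
    and mu: "0 < \<mu>" "\<epsilon> * schatten_norm 1 A \<le> \<mu>" and eps: "0 < \<epsilon>"
    and N: "1 \<le> (1 + \<epsilon> / 10^8)^N * (\<epsilon> / 10^8)"
  shows "acceptance N \<le> 1 - 1 / 648 * (1 / 72 * (1 / 144))"
proof (cases "scale = 0")
  case True
  then have "(\<Sum>l\<in>sign_lists d. (energy_at l)\<^sup>2) = 0"
    using finite_sign_lists sign_lists_nonempty by (simp add: scale_def avg_def)
  then have z: "energy_at l = 0" if "l \<in> sign_lists d" for l
    using that finite_sign_lists by (subst (asm) sum_nonneg_eq_0_iff) auto
  \<comment> \<open>This case does occur, for instance for the diagonal matrix with entries 1 and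
    -1. All starts have energy 0, so any nonzero gradient counts as large and one step of size 1
    suffices.\<close>
  have "acceptance N = E (\<lambda>h. E (\<lambda>x. survival 1 (Suc N) (vec_of_list x)))"
    unfolding acceptance_def by (intro avg_cong) (simp add: z step_size_def)
  also have "\<dots> = E (\<lambda>x. survival 1 (Suc N) (vec_of_list x))" by (rule avg_sign_const)
  also have "\<dots> \<le> 1 - 1 / 36 * (1 / 72)"
  proof (rule avg_le_one_minus[OF finite_sign_lists sign_lists_nonempty survival_le_1 _ _ start_correlation[OF v(1,2)]])
    fix l assume l: "l \<in> sign_lists d" "1 / 2 \<le> (form_at v l)\<^sup>2"
    have x: "vec_of_list l \<in> carrier_vec d" using l by simp
    have "0 < \<mu>\<^sup>2 * (scalar_prod (vec_of_list l) v)\<^sup>2"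
      using l(2) mu(1) by (intro mult_pos_pos) (auto simp: form_at_def zero_less_power2)
    also have "\<dots> \<le> scalar_prod (A *\<^sub>v vec_of_list l) (A *\<^sub>v vec_of_list l)"
      by (rule gradient_ge[OF v x])
    finally show "survival 1 (Suc N) (vec_of_list l) \<le> 1 - 1 / 72"
      using survival_large_gradient[OF x, of 1 N] True z[OF l(1)] by (simp add: energy_at_def)
  qed simp
  finally show ?thesis by simp
next
  case False
  then have sc: "0 < scale" using scale_nonneg by simp
  let ?f = "\<lambda>h x. if energy_at h < 0 \<or> energy_at x < 0 then 0
     else survival (step_size (energy_at h)) (Suc N) (vec_of_list x)"
  have f1: "?f h x \<le> 1" for h x by (simp add: survival_le_1)
  show ?thesis
    unfolding acceptance_def
  proof (rule avg_le_one_minus[OF finite_sign_lists sign_lists_nonempty _ _ _ avg_energy_square_typical[OF sc]])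
    fix h
    have "E (?f h) \<le> E (\<lambda>_. 1)" by (intro avg_mono f1)
    then show "E (?f h) \<le> 1" by (simp add: avg_sign_const)
  next
    fix h assume h: "h \<in> sign_lists d" "scale / 2 \<le> (energy_at h)\<^sup>2 \<and> (energy_at h)\<^sup>2 < 648 * scale"
    show "E (?f h) \<le> 1 - 1 / 72 * (1 / 144)"
    proof (rule avg_le_one_minus[OF finite_sign_lists sign_lists_nonempty f1])
      show "1 / 72 \<le> E (\<lambda>x. of_bool (1 / 2 \<le> (form_at v x)\<^sup>2 \<and> (energy_at x)\<^sup>2 < 72 * scale))"
        using avg_of_bool_conj[of "sign_lists d" "\<lambda>x. 1 / 2 \<le> (form_at v x)\<^sup>2" "\<lambda>x. (energy_at x)\<^sup>2 < 72 * scale"]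
          start_correlation[OF v(1,2)] avg_energy_square_large[OF _ sc, of 72] by simp
    next
      fix x assume x: "x \<in> sign_lists d" "1 / 2 \<le> (form_at v x)\<^sup>2 \<and> (energy_at x)\<^sup>2 < 72 * scale"
      have "vec_of_list x \<in> carrier_vec d" using x by simp
      then have "survival (step_size (energy_at h)) (Suc N) (vec_of_list x) \<le> 1 - 1 / 144"
        if "0 \<le> energy_at h" "0 \<le> energy_at x"
        using survival_typical_start[OF v mu eps N sc] h(2) x(2) that
        by (simp add: form_at_def energy_at_def)
      then show "?f h x \<le> 1 - 1 / 144" by simp
    qed simp
  qed simp
qed

end

section \<open>Coins, repetition and query count\<close>

definition trial_coins :: "nat \<Rightarrow> nat \<Rightarrow> (real list \<times> real list \<times> real list list) set" where
  "trial_coins d N = sign_lists d \<times> sign_lists d \<times> lists_of_length (sign_lists d) (Suc N)"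

definition coin_trial :: "real list \<times> real list \<times> real list list \<Rightarrow> query_tree" where
  "coin_trial = (\<lambda>(h, x, gs). trial (vec_of_list h) (vec_of_list x) (map vec_of_list gs))"

lemma trial_coins_carrier:
  assumes "(h, x, gs) \<in> trial_coins d N"
  shows "vec_of_list h \<in> carrier_vec d" "vec_of_list x \<in> carrier_vec d"
    "set (map vec_of_list gs) \<subseteq> carrier_vec d" "length gs = Suc N"
  using assms by (auto simp: trial_coins_def lists_of_length_def subset_iff)

lemma coin_trial:
  assumes "c \<in> trial_coins d N"
  shows queries_in_dim_coin_trial: "queries_in_dim d (coin_trial c)"
    and psd_run_coin_trial: "psd d A \<Longrightarrow> run A (coin_trial c)"
    and num_queries_coin_trial: "num_queries A (coin_trial c) \<le> 2 * Suc N + 2"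
proof -
  obtain h x gs where c: "c = (h, x, gs)" by (cases c)
  note car = trial_coins_carrier[OF assms[unfolded c]]
  have t: "coin_trial c = trial (vec_of_list h) (vec_of_list x) (map vec_of_list gs)"
    by (simp add: c coin_trial_def)
  show "queries_in_dim d (coin_trial c)"
    unfolding t by (rule queries_in_dim_trial[OF car(1-3)])
  show "run A (coin_trial c)" if "psd d A"
    unfolding t by (rule psd_run_trial[OF that car(1-3)])
  show "num_queries A (coin_trial c) \<le> 2 * Suc N + 2"
    using num_queries_trial[of A "vec_of_list h" "vec_of_list x" "map vec_of_list gs"]
    unfolding t length_map car(4) .
qed

lemma finite_trial_coins: "finite (trial_coins d N)" and trial_coins_nonempty: "trial_coins d N \<noteq> {}"
  by (auto simp: trial_coins_def finite_sign_lists finite_lists_of_length sign_lists_nonempty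
      lists_of_length_nonempty)

lemma (in symmetric_matrix) avg_coin_trial:
  "avg (trial_coins d N) (\<lambda>c. of_bool (run A (coin_trial c))) = acceptance N"
  unfolding trial_coins_def avg_Times acceptance_def
proof (intro avg_cong)
  fix h x
  show "avg (lists_of_length (sign_lists d) (Suc N)) (\<lambda>gs. of_bool (run A (coin_trial (h, x, gs))))
    = (if energy_at h < 0 \<or> energy_at x < 0 then 0
       else survival (step_size (energy_at h)) (Suc N) (vec_of_list x))"
    by (cases "energy_at h < 0"; cases "energy_at x < 0")
      (simp_all add: coin_trial_def trial_def energy_at_def energy_def survival_def avg_const
        finite_lists_of_length finite_sign_lists lists_of_length_nonempty sign_lists_nonempty)
qed

text \<open>Independence of the repetitions, which amplifies the one-sided error.\<close>

lemma avg_lists_all: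
  "avg (lists_of_length S n) (\<lambda>cs. of_bool (\<forall>c \<in> set cs. P c)) = (avg S (\<lambda>c. of_bool (P c)))^n"
proof (induction n)
  case (Suc n)
  have "avg (lists_of_length S (Suc n)) (\<lambda>cs. of_bool (\<forall>c \<in> set cs. P c))
     = avg S (\<lambda>x. avg (lists_of_length S n) (\<lambda>cs. of_bool (P x) * of_bool (\<forall>c \<in> set cs. P c)))"
    unfolding avg_lists_of_length_Suc by (intro avg_cong) auto
  also have "\<dots> = avg S (\<lambda>x. (avg S (\<lambda>c. of_bool (P c)))^n * of_bool (P x))"
    by (intro avg_cong) (simp only: avg_cmult Suc mult.commute)
  finally show ?case unfolding avg_cmult by (simp only: power_Suc mult.commute)
qed simp

text \<open>Passes from finitely many equally likely coins of any type to the coin type of the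
  theorem. PSD inputs are accepted surely, so the probability bound is required only for far
  inputs.\<close>

lemma finite_coins_tester:
  fixes T :: "'c \<Rightarrow> query_tree"
  assumes fin: "finite \<Omega>" "\<Omega> \<noteq> {}" and dim: "\<And>\<omega>. \<omega> \<in> \<Omega> \<Longrightarrow> queries_in_dim d (T \<omega>)"
    and psd: "\<And>A \<omega>. psd d A \<Longrightarrow> \<omega> \<in> \<Omega> \<Longrightarrow> run A (T \<omega>)"
    and far: "\<And>A. A \<in> sym_mats d \<Longrightarrow> A \<noteq> 0\<^sub>m d d \<Longrightarrow> lambda_min A \<le> - \<epsilon> * schatten_norm p A \<Longrightarrow>
      avg \<Omega> (\<lambda>\<omega>. of_bool (run A (T \<omega>))) \<le> 1 / 3"
    and num: "\<And>A \<omega>. A \<in> sym_mats d \<Longrightarrow> \<omega> \<in> \<Omega> \<Longrightarrow> real (num_queries A (T \<omega>)) \<le> q"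
  shows "\<exists>(M :: (nat \<Rightarrow> real) measure) T'. psd_tester d \<epsilon> p M T' \<and> one_sided d M T' \<and>
    (\<forall>A \<in> sym_mats d. \<forall>\<omega> \<in> space M. real (num_queries A (T' \<omega>)) \<le> q)"
proof -
  obtain e :: "'c \<Rightarrow> nat" where "inj_on e \<Omega>"
    using finite_imp_inj_to_nat_seg[OF fin(1)] by blast
  \<comment> \<open>Numbered coins are encoded as constant sequences; injectivity makes the uniform
    measure on the image agree with \<open>avg\<close>.\<close>
  define c where "c \<omega> = (\<lambda>_::nat. real (e \<omega>))" for \<omega>
  have c: "inj_on c \<Omega>"
    using \<open>inj_on e \<Omega>\<close> by (auto simp: inj_on_def c_def fun_eq_iff)
  define M where "M = uniform_count_measure (c ` \<Omega>)"
  define T' where "T' \<xi> = T (inv_into \<Omega> c \<xi>)" for \<xi>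
  have M: "space M = c ` \<Omega>" "sets M = Pow (c ` \<Omega>)"
    by (auto simp: M_def space_uniform_count_measure sets_uniform_count_measure)
  have T': "T' (c \<omega>) = T \<omega>" if "\<omega> \<in> \<Omega>" for \<omega>
    using that c by (simp add: T'_def)
  have pr: "prob_space M"
    unfolding M_def using fin by (intro prob_space_uniform_count_measure) auto
  then interpret prob_space M .
  have meas: "measure M {\<xi> \<in> space M. run A (T' \<xi>)} = avg \<Omega> (\<lambda>\<omega>. of_bool (run A (T \<omega>)))" for A
  proof -
    have "{\<xi> \<in> space M. run A (T' \<xi>)} = c ` {\<omega> \<in> \<Omega>. run A (T \<omega>)}"
      using T' by (auto simp: M)
    moreover have "card (c ` {\<omega> \<in> \<Omega>. run A (T \<omega>)}) = card {\<omega> \<in> \<Omega>. run A (T \<omega>)}"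
      using c by (intro card_image) (auto intro: inj_on_subset)
    ultimately show ?thesis
      using fin c unfolding M_def
      by (subst measure_uniform_count_measure) (auto simp: avg_def card_image Int_def)
  qed
  have neg: "measure M {\<xi> \<in> space M. \<not> run A (T' \<xi>)} = 1 - measure M {\<xi> \<in> space M. run A (T' \<xi>)}" for A
    by (rule prob_neg) (auto simp: M)
  have one: "one_sided d M T'" using psd T' by (auto simp: one_sided_def M)
  have "psd_tester d \<epsilon> p M T'"
    unfolding psd_tester_def vmv_algorithm_def
  proof (intro conjI ballI impI)
    fix A assume "psd d A"
    then have "{\<xi> \<in> space M. run A (T' \<xi>)} = space M" using one by (auto simp: one_sided_def)
    then show "2 / 3 \<le> measure M {\<xi> \<in> space M. run A (T' \<xi>)}" by (simp add: prob_space)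
  next
    fix A assume "A \<in> sym_mats d" "A \<noteq> 0\<^sub>m d d \<and> lambda_min A \<le> - \<epsilon> * schatten_norm p A"
    then show "2 / 3 \<le> measure M {\<xi> \<in> space M. \<not> run A (T' \<xi>)}"
      using far[of A] unfolding neg meas by simp
  qed (use pr dim T' in \<open>auto simp: M\<close>)
  then show ?thesis using one num T' by (intro exI[of _ M] exI[of _ T']) (auto simp: M)
qed

text \<open>With \<open>\<delta> = \<epsilon> / 10^8\<close>, about
  \<open>2 / \<delta> * ln (1 / \<delta>)\<close> steps suffice because
  \<open>ln (1 + \<delta>) \<ge> \<delta> / 2\<close>. For \<open>\<epsilon> \<le> 1 / 2\<close> the
  logarithm is at least 1/2, so its cube dominates it up to a factor 4.\<close>

lemma iteration_count:
  "\<exists>C>0. \<forall>\<epsilon>::real. 0 < \<epsilon> \<longrightarrow> \<epsilon> \<le> 1 / 2 \<longrightarrow>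
    (\<exists>N. 1 \<le> (1 + \<epsilon> / 10^8)^N * (\<epsilon> / 10^8) \<and> real N + 2 \<le> C * (1 / \<epsilon>) * ln (1 / \<epsilon>)^3)"
proof -
  define K :: real where "K = ln (10^8)"
  have K: "0 < K" by (simp add: K_def)
  define C where "C = 24 + 8 * 10^8 * (2 * K + 1)"
  have "\<exists>N. 1 \<le> (1 + \<epsilon> / 10^8)^N * (\<epsilon> / 10^8) \<and> real N + 2 \<le> C * (1 / \<epsilon>) * ln (1 / \<epsilon>)^3"
    if e: "0 < \<epsilon>" "\<epsilon> \<le> 1 / 2" for \<epsilon> :: real
  proof -
    define \<delta> where "\<delta> = \<epsilon> / 10^8"
    define l where "l = ln (1 / \<epsilon>)"
    have \<delta>: "0 < \<delta>" "\<delta> \<le> 1 / 2" using e by (auto simp: \<delta>_def)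
    have "exp (1 / 2) \<le> (2::real)" using exp_bound_half[of "1 / 2 :: real"] by simp
    also have "2 \<le> 1 / \<epsilon>" using e by (simp add: field_simps)
    finally have l: "1 / 2 \<le> l" unfolding l_def using e by (subst ln_ge_iff) auto
    have ld: "ln (1 / \<delta>) = K + l" using e by (simp add: \<delta>_def K_def l_def ln_div ln_mult)
    define N where "N = nat \<lceil>2 / \<delta> * ln (1 / \<delta>)\<rceil>"
    have "0 \<le> ln (1 / \<delta>)" using \<delta> by (intro ln_ge_zero) simp
    then have N0: "0 \<le> 2 / \<delta> * ln (1 / \<delta>)" using \<delta> by simp
    then have N: "2 / \<delta> * ln (1 / \<delta>) \<le> real N" "real N \<le> 2 / \<delta> * ln (1 / \<delta>) + 1"
      unfolding N_def by linarith+
    have "\<delta> - \<delta>\<^sup>2 \<le> ln (1 + \<delta>)" using \<delta> by (intro ln_one_plus_pos_lower_bound) auto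
    moreover have "\<delta>\<^sup>2 \<le> \<delta> * (1 / 2)" unfolding power2_eq_square using \<delta> by (intro mult_left_mono) auto
    ultimately have ln1: "\<delta> / 2 \<le> ln (1 + \<delta>)" by linarith
    have "ln (1 / \<delta>) = 2 / \<delta> * ln (1 / \<delta>) * (\<delta> / 2)" using \<delta> by simp
    also have "\<dots> \<le> real N * ln (1 + \<delta>)" using N N0 ln1 \<delta> by (intro mult_mono) auto
    also have "\<dots> = ln ((1 + \<delta>)^N)" using \<delta> by (simp add: ln_realpow)
    finally have "1 / \<delta> \<le> (1 + \<delta>)^N" using \<delta> by (subst (asm) ln_le_cancel_iff) auto
    then have g: "1 \<le> (1 + \<delta>)^N * \<delta>" using \<delta> by (simp add: field_simps)
    have "(1 / 2)\<^sup>2 \<le> l\<^sup>2" using l by (intro power_mono) auto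
    then have l2: "1 \<le> 4 * l\<^sup>2" by (simp add: power2_eq_square)
    have "l * 1 \<le> l * (4 * l\<^sup>2)" using l l2 by (intro mult_left_mono) auto
    then have l3: "l \<le> 4 * l^3" by (simp add: power2_eq_square power3_eq_cube)
    have "ln (1 / \<delta>) \<le> (2 * K + 1) * l" using l K unfolding ld by (simp add: algebra_simps)
    also have "\<dots> \<le> (2 * K + 1) * (4 * l^3)" using K l3 by (intro mult_left_mono) auto
    finally have "2 / \<delta> * ln (1 / \<delta>) \<le> 2 / \<delta> * ((2 * K + 1) * (4 * l^3))"
      using \<delta> by (intro mult_left_mono) auto
    also have "\<dots> = 8 * 10^8 * (2 * K + 1) * (1 / \<epsilon>) * l^3" by (simp add: \<delta>_def)
    finally have a: "real N \<le> 8 * 10^8 * (2 * K + 1) * (1 / \<epsilon>) * l^3 + 1" using N(2) by linarith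
    \<comment> \<open>The 24 in \<open>C\<close> absorbs the additive 3: the 2 of the claim and 1
      from rounding up.\<close>
    have "1 \<le> 8 * l^3" using l l3 by linarith
    also have "\<dots> \<le> 1 / \<epsilon> * (8 * l^3)"
      using mult_right_mono[of 1 "1 / \<epsilon>" "8 * l^3"] e l by (simp add: field_simps)
    finally have "3 \<le> 24 * (1 / \<epsilon>) * l^3" by simp
    moreover have "C * (1 / \<epsilon>) * l^3 = 24 * (1 / \<epsilon>) * l^3 + 8 * 10^8 * (2 * K + 1) * (1 / \<epsilon>) * l^3"
      unfolding C_def by (simp only: distrib_right)
    ultimately have "real N + 2 \<le> C * (1 / \<epsilon>) * l^3" using a by linarith
    with g show ?thesis unfolding \<delta>_def l_def by blast
  qed
  moreover have "0 < C" using K by (simp add: C_def add_pos_pos)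
  ultimately show ?thesis by blast
qed

theorem theorem2:
  shows "\<exists>C::real. C > 0 \<and>
    (\<forall>(d::nat) (\<epsilon>::real). 1 \<le> d \<longrightarrow> 0 < \<epsilon> \<longrightarrow> \<epsilon> \<le> 1 / 2 \<longrightarrow>
      (\<exists>(M :: (nat \<Rightarrow> real) measure) (T :: (nat \<Rightarrow> real) \<Rightarrow> query_tree).
         psd_tester d \<epsilon> 1 M T \<and> one_sided d M T \<and>
         (\<forall>A \<in> sym_mats d. \<forall>\<omega> \<in> space M.
            real (num_queries A (T \<omega>)) \<le> C * (1 / \<epsilon>) * ln (1 / \<epsilon>) ^ 3)))"
proof -
  obtain C where C: "0 < C" and N_ex: "\<And>\<epsilon>. 0 < \<epsilon> \<Longrightarrow> \<epsilon> \<le> 1 / 2 \<Longrightarrow>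
    \<exists>N. 1 \<le> (1 + \<epsilon> / 10^8)^N * (\<epsilon> / 10^8) \<and> real N + 2 \<le> C * (1 / \<epsilon>) * ln (1 / \<epsilon>)^3"
    using iteration_count by blast
  define p :: real where "p = 1 - 1 / 648 * (1 / 72 * (1 / 144))"
  have p: "0 \<le> p" "p < 1" by (simp_all add: p_def)
  \<comment> \<open>\<open>R\<close> depends only on the absolute constant \<open>p\<close>, so it
    is fixed before \<open>d\<close> and \<open>\<epsilon>\<close>.\<close>
  obtain R where R: "p^R < 1 / 3" using real_arch_pow_inv[of "1 / 3" p] p by auto
  \<comment> \<open>The \<open>+ 1\<close> makes positivity of the final constant immediate.\<close>
  have tester: "\<exists>(M :: (nat \<Rightarrow> real) measure) T. psd_tester d \<epsilon> 1 M T \<and> one_sided d M T \<and>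
      (\<forall>A \<in> sym_mats d. \<forall>\<omega> \<in> space M.
         real (num_queries A (T \<omega>)) \<le> (2 * real R + 1) * C * (1 / \<epsilon>) * ln (1 / \<epsilon>) ^ 3)"
    if d: "1 \<le> d" and e: "0 < \<epsilon>" "\<epsilon> \<le> 1 / 2" for d \<epsilon>
  proof -
    obtain N where N: "1 \<le> (1 + \<epsilon> / 10^8)^N * (\<epsilon> / 10^8)"
      and NC: "real N + 2 \<le> C * (1 / \<epsilon>) * ln (1 / \<epsilon>)^3"
      using N_ex[OF e] by blast
    let ?\<Omega> = "lists_of_length (trial_coins d N) R"
    show ?thesis
    proof (rule finite_coins_tester[where \<Omega> = ?\<Omega> and T = "\<lambda>cs. conjunction (map coin_trial cs)"])
      show "finite ?\<Omega>" "?\<Omega> \<noteq> {}"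
        by (auto simp: finite_lists_of_length finite_trial_coins lists_of_length_nonempty trial_coins_nonempty)
    next
      fix cs assume "cs \<in> ?\<Omega>"
      then have cs: "\<And>c. c \<in> set cs \<Longrightarrow> c \<in> trial_coins d N" "length cs = R"
        by (auto simp: lists_of_length_def)
      show "queries_in_dim d (conjunction (map coin_trial cs))"
        using cs(1) by (intro queries_in_dim_conjunction) (auto intro: queries_in_dim_coin_trial)
      show "run A (conjunction (map coin_trial cs))" if "psd d A" for A
        unfolding run_conjunction using cs(1) that by (auto intro: psd_run_coin_trial)
      have "num_queries A (conjunction (map coin_trial cs)) \<le> length (map coin_trial cs) * (2 * Suc N + 2)" for A
      proof (rule num_queries_conjunction)
        fix t assume "t \<in> set (map coin_trial cs)"
        then obtain c where "c \<in> set cs" "t = coin_trial c" by auto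
        then show "num_queries A t \<le> 2 * Suc N + 2"
          using num_queries_coin_trial[OF cs(1)] by (simp only:)
      qed
      then have "real (num_queries A (conjunction (map coin_trial cs))) \<le> real (R * (2 * Suc N + 2))" for A
        unfolding cs(2) length_map of_nat_le_iff .
      \<comment> \<open>A trial asks at most two initial queries and two for each of its
        \<open>N + 1\<close> steps, hence the \<open>N + 2\<close> in
        \<open>iteration_count\<close>.\<close>
      also have "real (R * (2 * Suc N + 2)) = 2 * real R * (real N + 2)" by (simp add: algebra_simps)
      also have "\<dots> \<le> (2 * real R + 1) * (C * (1 / \<epsilon>) * ln (1 / \<epsilon>)^3)"
        using NC by (intro mult_mono) auto
      finally show "real (num_queries A (conjunction (map coin_trial cs)))
        \<le> (2 * real R + 1) * C * (1 / \<epsilon>) * ln (1 / \<epsilon>) ^ 3" for A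
        by (simp add: mult.assoc)
    next
      fix A assume far: "A \<in> sym_mats d" "A \<noteq> 0\<^sub>m d d" "lambda_min A \<le> - \<epsilon> * schatten_norm 1 A"
      interpret symmetric_matrix d A by unfold_locales (rule far(1))
      obtain v where v: "v \<in> carrier_vec d" "scalar_prod v v = 1" "A *\<^sub>v v = lambda_min A \<cdot>\<^sub>v v"
        by (rule lambda_min_eigenvector[OF far(1) d])
      have "0 < \<epsilon> * schatten_norm 1 A"
        using symmetric_schatten_1_bounds(3)[OF far(1,2)] e by simp
      then have "acceptance N \<le> p"
        unfolding p_def using far(3) v
        by (intro acceptance_le[OF v(1,2), of "- lambda_min A" \<epsilon>] N e) auto
      moreover have "0 \<le> acceptance N"
        unfolding avg_coin_trial[symmetric] by (intro avg_nonneg) simp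
      ultimately have "(acceptance N)^R \<le> p^R" by (intro power_mono)
      then show "avg ?\<Omega> (\<lambda>cs. of_bool (run A (conjunction (map coin_trial cs)))) \<le> 1 / 3"
        using R avg_lists_all[of "trial_coins d N" R "\<lambda>c. run A (coin_trial c)"]
        by (simp add: run_conjunction avg_coin_trial)
    qed
  qed
  have "0 < (2 * real R + 1) * C" using C by simp
  then show ?thesis using tester by blast
qed

end
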